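(* Let $d,m\ge1$ and let $H_n=(\mathbf F_{d,n},\mathbf G_{m,n})$, $n\ge1$, be a sequence of $(d+m)$-dimensional random vectors such that $\mathbf F_{d,n}=(F_n^{(1)},\dots,F_n^{(d)})$ is a vector of $\mathbb Z_+$-valued elements of $\mathrm{dom}\,D$ and $\mathbf G_{m,n}=(G_n^{(1)},\dots,G_n^{(m)})$ is a vector of centered elements of $\mathrm{dom}\,D$. Assume that: (i) for every $i=1,\dots,d$, the sequence $n\mapsto\mathbb E\big[\int_Z(D_zF_n^{(i)})^2\mu(dz)\big]$ is bounded; (ii) there exists $\epsilon>1$ such that, for every $j=1,\dots,m$, $\lim_{n\to\infty}\mathbb E\big[\int_Z|D_zL^{-1}G_n^{(j)}|^{1+\epsilon}\mu(dz)\big]=0$. Then $$\lim_{n\to\infty}\beta(\mathbf F_{d,n},\mathbf G_{m,n})=0,\qquad\text{where}\quad \beta(\mathbf F_{d,n},\mathbf G_{m,n})=\sum_{i=1}^d\sum_{j=1}^m\mathbb E\int_Z|D_zL^{-1}G_n^{(j)}|\,|D_zF_n^{(i)}|\,\mu(dz).$$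
   Context: $(Z,\mathscr Z)$ is a Borel space with a $\sigma$-finite non-atomic Borel measure $\mu$. $\eta$ is a Poisson random measure on $Z$ with control (intensity) $\mu$, defined as the canonical mapping on $(\Omega,\mathscr F,\mathbb P)$, where $\Omega$ is the set of sums $\sum_{j=1}^n\delta_{z_j}$ ($n\in\mathbb N\cup\{\infty\}$, $z_j\in Z$) and $\mathscr F$ is generated by $\eta$; $\hat\eta=\eta-\mu$. $I_q(f)$ is the multiple Wiener–Itô integral of order $q$ of a symmetric $f\in L^2(\mu^q)$ with respect to $\hat\eta$. Each $F\in L^2(\mathbb P)$ has a unique chaotic decomposition $F=\mathbb E[F]+\sum_{k\ge1}I_k(f_k)$ with symmetric $f_k\in L^2(\mu^k)$. $F\in\mathrm{dom}\,D$ iff $\sum_k k\,k!\|f_k\|^2_{L^2(\mu^k)}<\infty$, and then $D_zF=\sum_{k\ge1}kI_{k-1}(f_k(z,\cdot))$; equivalently $D_zF(\omega)=F(\omega+\delta_z)-F(\omega)$ for $\mu$-a.e. $z$. For centered $F$, $L^{-1}F=-\sum_{k\ge1}\frac1kI_k(f_k)$. *)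

theory Defs
  imports "HOL-Probability.Probability" "HOL-Combinatorics.Permutations"
begin

section \<open>Borel spaces and non-atomic measures\<close>

definition borel_isomorphic :: "'a measure \<Rightarrow> 'b measure \<Rightarrow> bool" where
  "borel_isomorphic M N \<longleftrightarrow>
    (\<exists>f g. f \<in> M \<rightarrow>\<^sub>M N \<and> g \<in> N \<rightarrow>\<^sub>M M \<and>
      (\<forall>x\<in>space M. g (f x) = x) \<and> (\<forall>y\<in>space N. f (g y) = y))"

text \<open>A Borel space is a measurable space that is isomorphic to a Borel subset of \<open>[0,1]\<close>.\<close>

definition borel_space :: "'a measure \<Rightarrow> bool" where
  "borel_space M \<longleftrightarrow>
    (\<exists>S :: real set. S \<in> sets borel \<and> S \<subseteq> {0..1} \<and>
      borel_isomorphic M (restrict_space borel S))"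

definition non_atomic :: "'a measure \<Rightarrow> bool" where
  "non_atomic M \<longleftrightarrow>
    (\<forall>A\<in>sets M. 0 < emeasure M A \<longrightarrow>
      (\<exists>B\<in>sets M. B \<subseteq> A \<and> 0 < emeasure M B \<and> emeasure M B < emeasure M A))"


section \<open>Poisson random measures on the canonical space\<close>

text \<open>
  The measure \<^term>\<open>distr (count_space {j. enat j < n}) M z\<close> assigns to a measurable \<open>B\<close> the
  number of indices \<open>j < n\<close> with \<open>z j \<in> B\<close>, i.e. it is the sum of the Dirac masses at the points
  \<open>z j\<close> with \<open>j < n\<close>. The case \<open>n = 0\<close> is the zero measure.
\<close>

definition point_measures :: "'z measure \<Rightarrow> 'z measure set" where
  "point_measures M =
    {distr (count_space {j. enat j < n}) M z | (n :: enat) (z :: nat \<Rightarrow> 'z).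
      \<forall>j. enat j < n \<longrightarrow> z j \<in> space M}"

text \<open>
  The \<open>\<sigma>\<close>-algebra on the point measures generated by the canonical random measure
  \<open>\<eta>(\<omega>) = \<omega>\<close>, i.e. by all the evaluations \<open>\<omega> \<mapsto> \<omega>(B)\<close>.
\<close>

definition point_measure_algebra :: "'z measure \<Rightarrow> 'z measure measure" where
  "point_measure_algebra M =
    (SUP B\<in>sets M. vimage_algebra (point_measures M) (\<lambda>\<omega>. emeasure \<omega> B) borel)"

lemma space_point_measure_algebra: "space (point_measure_algebra M) = point_measures M"
  by (auto simp: point_measure_algebra_def space_Sup_eq_UN)

text \<open>
  The identity \<open>\<eta>(\<omega>) = \<omega>\<close> is a Poisson random measure with control \<open>\<mu>\<close> under the law \<open>P\<close>.
  Poisson variables of infinite mean need no separate clause: the values of \<open>\<eta>\<close> on sets of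
  infinite measure are determined by \<open>\<sigma>\<close>-finiteness.
\<close>

locale poisson_space =
  control: sigma_finite_measure \<mu> + P: prob_space P
  for \<mu> :: "'z measure" and P :: "'z measure measure" +
  assumes borel_control: "borel_space \<mu>"
    and non_atomic_control: "non_atomic \<mu>"
    and sets_P: "sets P = sets (point_measure_algebra \<mu>)"
    and poisson_distributed:
      "\<And>B k. B \<in> sets \<mu> \<Longrightarrow> emeasure \<mu> B < \<infinity> \<Longrightarrow>
        P.prob {\<omega> \<in> space P. emeasure \<omega> B = of_nat k}
          = measure \<mu> B ^ k / fact k * exp (- measure \<mu> B)"
    and independent_increments:
      "\<And>(n::nat) B. (\<And>i. i < n \<Longrightarrow> B i \<in> sets \<mu> \<and> emeasure \<mu> (B i) < \<infinity>) \<Longrightarrow>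
        disjoint_family_on B {..<n} \<Longrightarrow>
        P.indep_vars (\<lambda>_. borel) (\<lambda>i \<omega>. emeasure \<omega> (B i)) {..<n}"


section \<open>Square integrable functions\<close>

definition square_integrable :: "'a measure \<Rightarrow> ('a \<Rightarrow> real) \<Rightarrow> bool" where
  "square_integrable M f \<longleftrightarrow> f \<in> borel_measurable M \<and> integrable M (\<lambda>x. (f x)\<^sup>2)"

definition converges_L2 :: "'a measure \<Rightarrow> (nat \<Rightarrow> 'a \<Rightarrow> real) \<Rightarrow> ('a \<Rightarrow> real) \<Rightarrow> bool" where
  "converges_L2 M f g \<longleftrightarrow>
    (\<forall>n. square_integrable M (f n)) \<and> square_integrable M g \<and>
    (\<lambda>n. LINT x|M. (f n x - g x)\<^sup>2) \<longlonglongrightarrow> 0"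

text \<open>
  The power \<open>\<mu>\<^sup>q\<close>: points of \<open>Z\<^sup>q\<close> are functions on \<^typ>\<open>nat\<close> that are \<^const>\<open>undefined\<close> outside of
  \<open>{..<q}\<close>.
\<close>

abbreviation power_measure :: "'z measure \<Rightarrow> nat \<Rightarrow> (nat \<Rightarrow> 'z) measure" where
  "power_measure \<mu> q \<equiv> PiM {..<q} (\<lambda>_. \<mu>)"

definition symmetric_L2 :: "'z measure \<Rightarrow> nat \<Rightarrow> ((nat \<Rightarrow> 'z) \<Rightarrow> real) \<Rightarrow> bool" where
  "symmetric_L2 \<mu> q f \<longleftrightarrow> square_integrable (power_measure \<mu> q) f \<and>
    (\<forall>\<pi>. \<pi> permutes {..<q} \<longrightarrow> (AE x in power_measure \<mu> q. f (x \<circ> \<pi>) = f x))"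


section \<open>Multiple Wiener--Ito integrals\<close>

text \<open>
  On linear combinations of indicators of boxes \<open>A\<^sub>0 \<times> \<dots> \<times> A\<^sub>q\<^sub>-\<^sub>1\<close> with pairwise disjoint sides of
  finite measure, the integral is the linear extension of
  \<open>\<one>(A\<^sub>0 \<times> \<dots> \<times> A\<^sub>q\<^sub>-\<^sub>1) \<mapsto> (\<eta> - \<mu>)(A\<^sub>0) \<cdots> (\<eta> - \<mu>)(A\<^sub>q\<^sub>-\<^sub>1)\<close>. For \<open>q = 0\<close> this is the identity on constants.
\<close>

definition elementary_integral ::
  "'z measure \<Rightarrow> nat \<Rightarrow> ((nat \<Rightarrow> 'z) \<Rightarrow> real) \<Rightarrow> ('z measure \<Rightarrow> real) \<Rightarrow> bool" where
  "elementary_integral \<mu> q f X \<longleftrightarrow>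
    (\<exists>(N::nat) (a :: nat \<Rightarrow> real) (A :: nat \<Rightarrow> nat \<Rightarrow> 'z set).
      (\<forall>l<N. (\<forall>i<q. A l i \<in> sets \<mu> \<and> emeasure \<mu> (A l i) < \<infinity>) \<and>
             disjoint_family_on (A l) {..<q}) \<and>
      f = (\<lambda>x. \<Sum>l<N. a l * indicator (PiE {..<q} (A l)) x) \<and>
      X = (\<lambda>\<omega>. \<Sum>l<N. a l * (\<Prod>i<q. measure \<omega> (A l i) - measure \<mu> (A l i))))"

text \<open>
  The extension to \<open>L\<^sup>2(\<mu>\<^sup>q)\<close> by continuity. As \<open>I\<^sub>q(f)\<close> is an element of \<open>L\<^sup>2(P)\<close>, i.e. a random
  variable up to almost sure equality, the operators here and below are rendered as relations:
  \<open>multiple_integral \<mu> P q f X\<close> says that \<open>X\<close> is a version of \<open>I\<^sub>q(f)\<close>.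
\<close>

definition multiple_integral ::
  "'z measure \<Rightarrow> 'z measure measure \<Rightarrow> nat \<Rightarrow> ((nat \<Rightarrow> 'z) \<Rightarrow> real) \<Rightarrow> ('z measure \<Rightarrow> real) \<Rightarrow> bool"
  where
  "multiple_integral \<mu> P q f X \<longleftrightarrow>
    (\<exists>fs Xs. (\<forall>n. elementary_integral \<mu> q (fs n) (Xs n)) \<and>
      converges_L2 (power_measure \<mu> q) fs f \<and> converges_L2 P Xs X)"


section \<open>Chaotic decomposition, Malliavin derivative and pseudo-inverse of the generator\<close>

text \<open>
  \<open>F = E[F] + \<Sum>\<^sub>k\<^sub>\<ge>\<^sub>1 I\<^sub>k(f\<^sub>k)\<close> in \<open>L\<^sup>2(P)\<close>, where \<open>X k\<close> is a version of \<open>I\<^sub>k(f\<^sub>k)\<close>. The values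
  \<open>f 0\<close> and \<open>X 0\<close> play no role.
\<close>

definition chaotic_decomposition ::
  "'z measure \<Rightarrow> 'z measure measure \<Rightarrow> ('z measure \<Rightarrow> real) \<Rightarrow>
    (nat \<Rightarrow> (nat \<Rightarrow> 'z) \<Rightarrow> real) \<Rightarrow> (nat \<Rightarrow> 'z measure \<Rightarrow> real) \<Rightarrow> bool" where
  "chaotic_decomposition \<mu> P F f X \<longleftrightarrow>
    (\<forall>k\<ge>1. symmetric_L2 \<mu> k (f k) \<and> multiple_integral \<mu> P k (f k) (X k)) \<and>
    converges_L2 P (\<lambda>N \<omega>. (LINT \<omega>'|P. F \<omega>') + (\<Sum>k=1..N. X k \<omega>)) F"

definition derivative_summable :: "'z measure \<Rightarrow> (nat \<Rightarrow> (nat \<Rightarrow> 'z) \<Rightarrow> real) \<Rightarrow> bool" where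
  "derivative_summable \<mu> f \<longleftrightarrow>
    summable (\<lambda>k. real (Suc k) * fact (Suc k) *
      (LINT x|power_measure \<mu> (Suc k). (f (Suc k) x)\<^sup>2))"

definition dom_D :: "'z measure \<Rightarrow> 'z measure measure \<Rightarrow> ('z measure \<Rightarrow> real) set" where
  "dom_D \<mu> P = {F. \<exists>f X. chaotic_decomposition \<mu> P F f X \<and> derivative_summable \<mu> f}"

text \<open>
  \<open>U\<close> is a jointly measurable version of \<open>(z, \<omega>) \<mapsto> D\<^sub>zF(\<omega>)\<close>, where
  \<open>D\<^sub>zF = \<Sum>\<^sub>k\<^sub>\<ge>\<^sub>0 (k + 1) I\<^sub>k(f\<^sub>k\<^sub>+\<^sub>1(z, \<cdot>))\<close> for almost every \<open>z\<close>. The point \<open>(z, x\<^sub>0, \<dots>, x\<^sub>k\<^sub>-\<^sub>1)\<close>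
  is \<^term>\<open>case_nat z x\<close>.
\<close>

definition malliavin_derivative ::
  "'z measure \<Rightarrow> 'z measure measure \<Rightarrow> ('z measure \<Rightarrow> real) \<Rightarrow> ('z \<Rightarrow> 'z measure \<Rightarrow> real) \<Rightarrow> bool"
  where
  "malliavin_derivative \<mu> P F U \<longleftrightarrow>
    (\<lambda>(z, \<omega>). U z \<omega>) \<in> borel_measurable (\<mu> \<Otimes>\<^sub>M P) \<and>
    (\<exists>f X. chaotic_decomposition \<mu> P F f X \<and> derivative_summable \<mu> f \<and>
      (AE z in \<mu>. \<exists>Y.
        (\<forall>k. multiple_integral \<mu> P k (\<lambda>x. f (Suc k) (case_nat z x)) (Y k)) \<and>
        converges_L2 P (\<lambda>N \<omega>. \<Sum>k<N. real (Suc k) * Y k \<omega>) (U z)))"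

text \<open>\<open>Y\<close> is a version of \<open>L\<^sup>-\<^sup>1F = - \<Sum>\<^sub>k\<^sub>\<ge>\<^sub>1 (1/k) I\<^sub>k(f\<^sub>k)\<close>, for centered \<open>F\<close>.\<close>

definition pseudo_inverse_L ::
  "'z measure \<Rightarrow> 'z measure measure \<Rightarrow> ('z measure \<Rightarrow> real) \<Rightarrow> ('z measure \<Rightarrow> real) \<Rightarrow> bool" where
  "pseudo_inverse_L \<mu> P F Y \<longleftrightarrow>
    (LINT \<omega>|P. F \<omega>) = 0 \<and>
    (\<exists>f X. chaotic_decomposition \<mu> P F f X \<and>
      converges_L2 P (\<lambda>N \<omega>. - (\<Sum>k=1..N. 1 / real k * X k \<omega>)) Y)"

text \<open>
  The functional \<open>\<beta>\<close>, in terms of the derivatives \<open>U i = DF\<^sup>(\<^sup>i\<^sup>)\<close> and \<open>V j = DL\<^sup>-\<^sup>1G\<^sup>(\<^sup>j\<^sup>)\<close>.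
\<close>

definition beta_coefficient ::
  "'z measure \<Rightarrow> 'z measure measure \<Rightarrow> nat \<Rightarrow> nat \<Rightarrow>
    (nat \<Rightarrow> 'z \<Rightarrow> 'z measure \<Rightarrow> real) \<Rightarrow> (nat \<Rightarrow> 'z \<Rightarrow> 'z measure \<Rightarrow> real) \<Rightarrow> ennreal" where
  "beta_coefficient \<mu> P d m U V =
    (\<Sum>i=1..d. \<Sum>j=1..m. \<integral>\<^sup>+ \<omega>. (\<integral>\<^sup>+ z. ennreal (\<bar>V j z \<omega>\<bar> * \<bar>U i z \<omega>\<bar>) \<partial>\<mu>) \<partial>P)"

end

theory Submission
  imports Defs
begin

text \<open>
  If \<open>F\<close> takes its values in the naturals, then adding a point changes \<open>F\<close> by an integer, so \<open>D\<^sub>zF\<close> is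
  an integer for almost all \<open>(z, \<omega>)\<close>. A nonzero integer has modulus at least \<open>1\<close>, and this gives for
  every \<open>\<delta> > 0\<close> the pointwise bound
  \<open>|v| |D\<^sub>zF| \<le> \<delta> (D\<^sub>zF)\<^sup>2 + \<delta>\<^sup>-\<^sup>\<epsilon> |v|\<^sup>1\<^sup>+\<^sup>\<epsilon>\<close>
  (lemma \<open>product_le_of_integer\<close>). For \<open>v = D\<^sub>zL\<^sup>-\<^sup>1G\<close> the integral of the second term
  tends to \<open>0\<close> along the sequence by assumption, and the integral of the first is at most \<open>\<delta>\<close> times
  the bound for \<open>E[\<integral> (D\<^sub>zF)\<^sup>2 \<mu>(dz)]\<close>. Afterwards let \<open>\<delta> \<rightarrow> 0\<close>.

  The work lies in the integer values of \<open>D\<^sub>zF\<close> (lemma \<open>derivative_integer\<close>), because the derivative is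
  defined through the chaotic decomposition and not as a difference. The link between the two is the
  Mecke formula for functionals of the counts \<open>\<omega>(A)\<close> on finitely many sets
  (lemma \<open>mecke_cylinder\<close>), which is an identity for independent Poisson variables on the atoms
  that these sets generate. It has two uses.

  First, it gives by induction on the order the Ito inequality \<open>E[I\<^sub>q(f)\<^sup>2] \<le> q! \<parallel>f\<parallel>\<^sup>2\<close> for step functions
  \<open>f\<close> (lemma \<open>ito_inequality\<close>), since the difference operator takes an integral of order \<open>q\<close> to a sum of
  \<open>q\<close> integrals of order \<open>q - 1\<close>. Hence \<open>F\<close> is the \<open>L\<^sup>2\<close> limit of functionals \<open>W\<^sub>n\<close> of finitely many
  counts whose differences \<open>W\<^sub>n(\<omega> + \<delta>\<^sub>z) - W\<^sub>n(\<omega>)\<close> converge to \<open>D\<^sub>zF\<close> in \<open>L\<^sup>2(P)\<close> for almost every \<open>z\<close>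
  (lemma \<open>derivative_approximation\<close>).

  Second, applied to \<open>cos(2\<pi>W\<^sub>n)\<close> it yields in the limit
  \<open>E[\<omega>(B) cos(2\<pi>F)] = \<integral>\<^sub>B E[cos(2\<pi>(F + D\<^sub>zF))] \<mu>(dz)\<close>
  whenever \<open>\<mu>(B)\<close> is finite. For integer valued \<open>F\<close> this says that \<open>cos(2\<pi>D\<^sub>zF)\<close> has the mean value \<open>1\<close> on
  \<open>B \<times> \<Omega>\<close>, so that it is \<open>1\<close> almost everywhere.
\<close>

section \<open>Poisson counts on disjoint sets\<close>

definition poisson_weight :: "real \<Rightarrow> nat \<Rightarrow> real" where
  "poisson_weight r k = r ^ k / fact k * exp (- r)"

lemma poisson_weight_nonneg: "0 \<le> r \<Longrightarrow> 0 \<le> poisson_weight r k"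
  by (simp add: poisson_weight_def)

lemma poisson_weight_sums: "poisson_weight r sums 1"
proof -
  have "(\<lambda>k. r ^ k /\<^sub>R fact k * exp (- r)) sums (exp r * exp (- r))"
    by (intro sums_mult2 exp_converges)
  then show ?thesis
    by (simp add: poisson_weight_def[abs_def] exp_minus field_simps scaleR_conv_of_real)
qed

text \<open>
  The one-dimensional Mecke identity, from which the one for point measures is assembled.
\<close>

lemma poisson_weight_Suc:
  "real (Suc k) * poisson_weight r (Suc k) = r * poisson_weight r k"
  by (simp add: poisson_weight_def field_simps del: of_nat_Suc)

lemma (in poisson_space) measurable_evaluation [measurable]:
  assumes "B \<in> sets \<mu>"
  shows "(\<lambda>\<omega>. emeasure \<omega> B) \<in> borel_measurable P"
proof -
  have "(\<lambda>\<omega>. emeasure \<omega> B) \<in> borel_measurable (point_measure_algebra \<mu>)"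
    unfolding point_measure_algebra_def
    by (rule measurable_SUP1[OF assms]) (auto intro: measurable_vimage_algebra1)
  then show ?thesis
    by (subst measurable_cong_sets[OF sets_P refl])
qed

lemma (in poisson_space) measurable_measure_evaluation [measurable]:
  assumes "B \<in> sets \<mu>"
  shows "(\<lambda>\<omega>. measure \<omega> B) \<in> borel_measurable P"
  using assms unfolding measure_def by measurable

lemma (in poisson_space) sets_point_measure:
  assumes "\<omega> \<in> space P"
  shows "sets \<omega> = sets \<mu>"
proof -
  have "space P = point_measures \<mu>"
    using sets_eq_imp_space_eq[OF sets_P] by (simp add: space_point_measure_algebra)
  then show ?thesis using assms by (auto simp: point_measures_def)
qed

lemma (in poisson_space) prob_counts:
  assumes J: "finite J" and dis: "disjoint_family_on B J"
    and B: "\<And>j. j \<in> J \<Longrightarrow> B j \<in> sets \<mu>" "\<And>j. j \<in> J \<Longrightarrow> emeasure \<mu> (B j) < \<infinity>"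
  shows "P.prob {\<omega> \<in> space P. \<forall>j\<in>J. emeasure \<omega> (B j) = of_nat (k j)}
    = (\<Prod>j\<in>J. poisson_weight (measure \<mu> (B j)) (k j))"
proof (cases "J = {}")
  case True
  then show ?thesis by (simp add: P.prob_space)
next
  case False
  obtain h where h: "bij_betw h {..<card J} J"
    using ex_bij_betw_nat_finite[OF J] by (auto simp: atLeast0LessThan)
  have hJ: "h i \<in> J" if "i < card J" for i using h that by (auto simp: bij_betw_def)
  have dis': "disjoint_family_on (\<lambda>i. B (h i)) {..<card J}"
    unfolding disjoint_family_on_def
  proof (intro ballI impI)
    fix m n assume mn: "m \<in> {..<card J}" "n \<in> {..<card J}" "m \<noteq> n"
    then have "h m \<noteq> h n" using h by (auto simp: bij_betw_def inj_on_def)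
    then show "B (h m) \<inter> B (h n) = {}"
      using dis mn hJ by (auto simp: disjoint_family_on_def)
  qed
  have ind: "P.indep_vars (\<lambda>_. borel) (\<lambda>i \<omega>. emeasure \<omega> (B (h i))) {..<card J}"
    by (rule independent_increments) (use dis' hJ B in auto)
  have ne: "{..<card J} \<noteq> {}" using False J by (simp add: lessThan_empty_iff)
  have "P.prob {\<omega> \<in> space P. \<forall>j\<in>J. emeasure \<omega> (B j) = of_nat (k j)}
      = P.prob (\<Inter>i\<in>{..<card J}. (\<lambda>\<omega>. emeasure \<omega> (B (h i))) -` {of_nat (k (h i))} \<inter> space P)"
  proof -
    have "(\<forall>j\<in>J. Q j) \<longleftrightarrow> (\<forall>i<card J. Q (h i))" for Q
      using h hJ by (metis bij_betw_imp_surj_on imageE lessThan_iff)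
    then show ?thesis
      using ne by (intro arg_cong[of _ _ P.prob]) auto
  qed
  also have "\<dots> = (\<Prod>i<card J. P.prob ((\<lambda>\<omega>. emeasure \<omega> (B (h i))) -` {of_nat (k (h i))} \<inter> space P))"
    by (rule P.indep_varsD[OF ind ne]) auto
  also have "\<dots> = (\<Prod>i<card J. poisson_weight (measure \<mu> (B (h i))) (k (h i)))"
  proof (intro prod.cong refl)
    fix i assume "i \<in> {..<card J}"
    then have "h i \<in> J" using hJ by auto
    then show "P.prob ((\<lambda>\<omega>. emeasure \<omega> (B (h i))) -` {of_nat (k (h i))} \<inter> space P)
        = poisson_weight (measure \<mu> (B (h i))) (k (h i))"
      using poisson_distributed[of "B (h i)" "k (h i)"] B
      by (simp add: poisson_weight_def vimage_def Int_def conj_commute)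
  qed
  also have "\<dots> = (\<Prod>j\<in>J. poisson_weight (measure \<mu> (B j)) (k j))"
    by (rule prod.reindex_bij_betw[OF h])
  finally show ?thesis .
qed

text \<open>
  For \<open>\<omega>(A)\<close> infinite, \<^term>\<open>measure \<omega> A\<close> and hence the count are \<open>0\<close>; this happens with probability
  \<open>0\<close> if \<open>\<mu>(A)\<close> is finite.
\<close>

definition point_count :: "'z measure \<Rightarrow> 'z set \<Rightarrow> nat" where
  "point_count \<omega> A = nat \<lfloor>measure \<omega> A\<rfloor>"

text \<open>
  The Poisson weights add up to \<open>1\<close>, which leaves no mass for infinite or fractional values of
  \<open>\<omega>(B)\<close>.
\<close>

lemma (in poisson_space) AE_count:
  assumes B: "B \<in> sets \<mu>" "emeasure \<mu> B < \<infinity>"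
  shows "AE \<omega> in P. emeasure \<omega> B = of_nat (point_count \<omega> B)"
proof -
  define E where "E k = {\<omega> \<in> space P. emeasure \<omega> B = of_nat k}" for k :: nat
  have E[measurable]: "E k \<in> sets P" for k
    using B unfolding E_def by measurable
  have "(\<lambda>k. P.prob (E k)) sums P.prob (\<Union>k. E k)"
  proof (rule P.finite_measure_UNION)
    show "range E \<subseteq> P.events" using E by auto
    show "disjoint_family E" by (auto simp: disjoint_family_on_def E_def)
  qed
  moreover have "P.prob (E k) = poisson_weight (measure \<mu> B) k" for k
    using poisson_distributed[OF B] by (simp add: E_def poisson_weight_def)
  ultimately have "P.prob (\<Union>k. E k) = 1"
    using poisson_weight_sums[of "measure \<mu> B"] by (auto intro: sums_unique2)
  then have "AE \<omega> in P. \<omega> \<in> (\<Union>k. E k)"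
    by (subst P.prob_eq_1[symmetric]) auto
  then show ?thesis
  proof eventually_elim
    case (elim \<omega>)
    then obtain k where k: "emeasure \<omega> B = of_nat k" by (auto simp: E_def)
    then have "measure \<omega> B = real k" by (simp add: measure_def)
    then show ?case using k by (simp add: point_count_def)
  qed
qed

lemma measure_eq_count:
  "emeasure \<omega> B = of_nat (point_count \<omega> B) \<Longrightarrow> measure \<omega> B = real (point_count \<omega> B)"
  by (simp add: measure_def)

text \<open>
  Independence makes the vector of counts on disjoint sets a discrete random vector with product
  weights. As that law sits on the countable set of vectors of naturals, \<open>H\<close> may be any function,
  and all later measurability questions about functions of the counts disappear.
\<close>

lemma (in poisson_space) nn_integral_counts:
  fixes H :: "('j \<Rightarrow> nat) \<Rightarrow> ennreal"
  assumes J: "finite J" and dis: "disjoint_family_on B J"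
    and B: "\<And>j. j \<in> J \<Longrightarrow> B j \<in> sets \<mu>" "\<And>j. j \<in> J \<Longrightarrow> emeasure \<mu> (B j) < \<infinity>"
  shows "(\<integral>\<^sup>+\<omega>. H (\<lambda>j\<in>J. point_count \<omega> (B j)) \<partial>P)
    = (\<integral>\<^sup>+k. H k * ennreal (\<Prod>j\<in>J. poisson_weight (measure \<mu> (B j)) (k j))
        \<partial>count_space (J \<rightarrow>\<^sub>E UNIV))"
proof -
  define E where "E k = {\<omega> \<in> space P. \<forall>j\<in>J. emeasure \<omega> (B j) = of_nat (k j)}" for k :: "'j \<Rightarrow> nat"
  have E[measurable]: "E k \<in> sets P" for k
  proof -
    have "{\<omega> \<in> space P. emeasure \<omega> (B j) = of_nat (k j)} \<in> sets P" if "j \<in> J" for j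
      using B(1)[OF that] by measurable
    then show ?thesis unfolding E_def by (intro sets.sets_Collect_finite_All J)
  qed
  \<comment> \<open>Almost surely exactly one vector \<open>k\<close> has \<open>\<omega> \<in> E k\<close>, namely the vector of counts.\<close>
  have ae: "AE \<omega> in P. \<forall>j\<in>J. emeasure \<omega> (B j) = of_nat (point_count \<omega> (B j))"
    using J B by (intro AE_finite_allI AE_count) auto
  have "(\<integral>\<^sup>+\<omega>. H (\<lambda>j\<in>J. point_count \<omega> (B j)) \<partial>P)
      = (\<integral>\<^sup>+\<omega>. (\<integral>\<^sup>+k. H k * indicator (E k) \<omega> \<partial>count_space (J \<rightarrow>\<^sub>E UNIV)) \<partial>P)"
  proof (rule nn_integral_cong_AE, use ae AE_space in eventually_elim)
    fix \<omega> assume c: "\<forall>j\<in>J. emeasure \<omega> (B j) = of_nat (point_count \<omega> (B j))" and w: "\<omega> \<in> space P"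
    let ?N = "\<lambda>j\<in>J. point_count \<omega> (B j)"
    have "(\<integral>\<^sup>+k. H k * indicator (E k) \<omega> \<partial>count_space (J \<rightarrow>\<^sub>E UNIV))
        = (\<integral>\<^sup>+k. H k * indicator {?N} k \<partial>count_space (J \<rightarrow>\<^sub>E UNIV))"
    proof (intro nn_integral_cong arg_cong2[where f="(*)"] refl)
      fix k assume "k \<in> space (count_space (J \<rightarrow>\<^sub>E (UNIV::nat set)))"
      then have k: "k \<in> extensional J" by (simp add: PiE_def)
      have "\<omega> \<in> E k \<longleftrightarrow> (\<forall>j\<in>J. point_count \<omega> (B j) = k j)"
        using c w by (auto simp: E_def)
      also have "\<dots> \<longleftrightarrow> k = ?N"
        using k by (auto intro!: extensionalityI[of _ J] simp: restrict_extensional)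
      finally show "indicator (E k) \<omega> = (indicator {?N} k :: ennreal)"
        by (auto simp: indicator_def)
    qed
    also have "\<dots> = H ?N * emeasure (count_space (J \<rightarrow>\<^sub>E (UNIV::nat set))) {?N}"
      by (rule nn_integral_indicator_singleton) auto
    also have "\<dots> = H ?N" by (subst emeasure_count_space) (auto split: if_splits)
    finally show "H ?N = (\<integral>\<^sup>+k. H k * indicator (E k) \<omega> \<partial>count_space (J \<rightarrow>\<^sub>E UNIV))" ..
  qed
  also have "\<dots> = (\<integral>\<^sup>+k. (\<integral>\<^sup>+\<omega>. H k * indicator (E k) \<omega> \<partial>P) \<partial>count_space (J \<rightarrow>\<^sub>E UNIV))"
  proof (rule nn_integral_count_space_nn_integral)
    show "countable (J \<rightarrow>\<^sub>E (UNIV :: nat set))" using J by (intro countable_PiE) auto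
  qed simp
  also have "\<dots> = (\<integral>\<^sup>+k. H k * ennreal (\<Prod>j\<in>J. poisson_weight (measure \<mu> (B j)) (k j))
        \<partial>count_space (J \<rightarrow>\<^sub>E UNIV))"
    using prob_counts[OF J dis B] E
    by (intro nn_integral_cong)
      (simp add: nn_integral_cmult_indicator P.emeasure_eq_measure, simp add: E_def)
  finally show ?thesis .
qed

text \<open>
  The Mecke identity for a vector of independent Poisson variables, in one coordinate \<open>t\<close>: the
  substitution \<open>k \<mapsto> k + e\<^sub>t\<close> and the recursion of the weights in \<open>k\<^sub>t\<close>.
\<close>

lemma nn_integral_poisson_weights_shift:
  fixes h :: "('j \<Rightarrow> nat) \<Rightarrow> ennreal"
  assumes J: "finite J" "t \<in> J" and r: "\<And>j. j \<in> J \<Longrightarrow> 0 \<le> r j"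
  defines "p \<equiv> \<lambda>k. ennreal (\<Prod>j\<in>J. poisson_weight (r j) (k j))"
  shows "(\<integral>\<^sup>+k. of_nat (k t) * h k * p k \<partial>count_space (J \<rightarrow>\<^sub>E UNIV))
    = ennreal (r t) * (\<integral>\<^sup>+k. h (k(t := Suc (k t))) * p k \<partial>count_space (J \<rightarrow>\<^sub>E UNIV))"
proof -
  let ?S = "J \<rightarrow>\<^sub>E (UNIV::nat set)"
  let ?u = "\<lambda>k. k(t := Suc (k t))"
  \<comment> \<open>The terms with \<open>k\<^sub>t = 0\<close> vanish, and the others are reached by raising \<open>k\<^sub>t\<close> by one.\<close>
  have bij: "bij_betw ?u ?S {k \<in> ?S. 0 < k t}"
    by (rule bij_betwI[where g="\<lambda>k. k(t := k t - 1)"])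
      (use J in \<open>auto simp: PiE_iff extensional_def fun_eq_iff\<close>)
  have w: "of_nat (?u k t) * p (?u k) = ennreal (r t) * p k" for k
  proof -
    have split: "(\<Prod>j\<in>J. poisson_weight (r j) (f j))
        = poisson_weight (r t) (f t) * (\<Prod>j\<in>J - {t}. poisson_weight (r j) (f j))" for f
      by (rule prod.remove[OF J])
    have "real (?u k t) * (\<Prod>j\<in>J. poisson_weight (r j) (?u k j))
        = (real (Suc (k t)) * poisson_weight (r t) (Suc (k t)))
          * (\<Prod>j\<in>J - {t}. poisson_weight (r j) (k j))"
      by (simp add: split)
    also have "\<dots> = r t * (\<Prod>j\<in>J. poisson_weight (r j) (k j))"
      unfolding poisson_weight_Suc by (simp add: split)
    finally show ?thesis
      using r J(2) unfolding p_def ennreal_of_nat_eq_real_of_nat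
      by (subst (1 2) ennreal_mult[symmetric])
        (auto intro!: prod_nonneg poisson_weight_nonneg)
  qed
  have "(\<integral>\<^sup>+k. of_nat (k t) * h k * p k \<partial>count_space ?S)
      = (\<integral>\<^sup>+k. of_nat (k t) * h k * p k \<partial>count_space {k \<in> ?S. 0 < k t})"
    by (rule nn_integral_count_space_eq) auto
  also have "\<dots> = (\<integral>\<^sup>+k. of_nat (?u k t) * h (?u k) * p (?u k) \<partial>count_space ?S)"
    by (rule nn_integral_bij_count_space[OF bij, symmetric])
  also have "\<dots> = (\<integral>\<^sup>+k. ennreal (r t) * (h (?u k) * p k) \<partial>count_space ?S)"
  proof (rule nn_integral_cong)
    fix k
    show "of_nat (?u k t) * h (?u k) * p (?u k) = ennreal (r t) * (h (?u k) * p k)"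
      using w[of k] by (metis mult.assoc mult.commute)
  qed
  also have "\<dots> = ennreal (r t) * (\<integral>\<^sup>+k. h (?u k) * p k \<partial>count_space ?S)"
    by (rule nn_integral_cmult) simp
  finally show ?thesis .
qed

section \<open>The Mecke formula for functionals of finitely many counts\<close>

text \<open>
  A functional of the point measure is represented as a function \<open>G\<close> of the set function
  \<open>c = measure \<omega>\<close>. Adding a point at \<open>z\<close> then acts on \<open>c\<close>, so that no map between point measures
  has to be constructed and shown to be measurable.
\<close>

definition depends_on :: "'z set set \<Rightarrow> (('z set \<Rightarrow> real) \<Rightarrow> 'b) \<Rightarrow> bool" where
  "depends_on \<B> G \<longleftrightarrow> (\<forall>c c'. (\<forall>A\<in>\<B>. c A = c' A) \<longrightarrow> G c = G c')"

definition add_point :: "'z \<Rightarrow> ('z set \<Rightarrow> real) \<Rightarrow> 'z set \<Rightarrow> real" where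
  "add_point z c = (\<lambda>A. c A + indicator A z)"

text \<open>
  The atoms of the algebra generated by \<open>\<B>\<close>, labelled by the set \<open>s\<close> of members of \<open>\<B>\<close> that contain
  the atom. The label \<open>{}\<close> belongs to the complement of the union of \<open>\<B>\<close>, where \<open>\<mu>\<close> may be infinite.
\<close>

definition atom :: "'z measure \<Rightarrow> 'z set set \<Rightarrow> 'z set set \<Rightarrow> 'z set" where
  "atom M \<B> s = {x \<in> space M. \<forall>A\<in>\<B>. x \<in> A \<longleftrightarrow> A \<in> s}"

lemma sets_atom:
  assumes "finite \<B>" "\<And>A. A \<in> \<B> \<Longrightarrow> A \<in> sets M"
  shows "atom M \<B> s \<in> sets M"
  unfolding atom_def
proof (intro sets.sets_Collect_finite_All assms(1))
  fix A assume "A \<in> \<B>"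
  then have [measurable]: "A \<in> sets M" by (rule assms(2))
  show "{x \<in> space M. (x \<in> A) = (A \<in> s)} \<in> sets M" by measurable
qed

lemma disjoint_atoms: "disjoint_family_on (atom M \<B>) (Pow \<B> - {{}})"
  unfolding disjoint_family_on_def atom_def by auto

lemma union_atoms:
  assumes "A \<in> \<B>" "A \<subseteq> space M"
  shows "A = (\<Union>s\<in>{s \<in> Pow \<B> - {{}}. A \<in> s}. atom M \<B> s)"
proof (intro set_eqI iffI)
  fix x assume x: "x \<in> A"
  have "x \<in> atom M \<B> {C \<in> \<B>. x \<in> C}"
    using x assms by (auto simp: atom_def)
  then show "x \<in> (\<Union>s\<in>{s \<in> Pow \<B> - {{}}. A \<in> s}. atom M \<B> s)"
    using x assms by (intro UN_I[of "{C \<in> \<B>. x \<in> C}"]) auto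
qed (use assms in \<open>auto simp: atom_def\<close>)

text \<open>
  Almost surely every count \<open>\<omega>(A)\<close> with \<open>A \<in> \<B>\<close> is the sum of the counts on the atoms inside \<open>A\<close>,
  so both sides are integrals of functions of a vector of independent Poisson variables. A point \<open>z\<close>
  in the atom \<open>t\<close> raises exactly the coordinate \<open>t\<close> by one, and the claim is the sum of the
  coordinatewise identities over the atoms \<open>t\<close> inside \<open>B\<close>.
\<close>

lemma (in poisson_space) mecke_cylinder:
  fixes G :: "('z set \<Rightarrow> real) \<Rightarrow> ennreal"
  assumes fin: "finite \<B>"
    and \<B>: "\<And>A. A \<in> \<B> \<Longrightarrow> A \<in> sets \<mu>" "\<And>A. A \<in> \<B> \<Longrightarrow> emeasure \<mu> A < \<infinity>"
    and B: "B \<in> \<B>"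
    and G: "depends_on \<B> G"
  shows "(\<integral>\<^sup>+\<omega>. ennreal (measure \<omega> B) * G (measure \<omega>) \<partial>P)
    = (\<integral>\<^sup>+z. indicator B z * (\<integral>\<^sup>+\<omega>. G (add_point z (measure \<omega>)) \<partial>P) \<partial>\<mu>)"
proof -
  define J where "J = Pow \<B> - {{}}"
  define C where "C = atom \<mu> \<B>"
  define T where "T A = {s \<in> J. A \<in> s}" for A
  have J: "finite J" using fin by (simp add: J_def)
  have T: "finite (T A)" "T A \<subseteq> J" for A using J by (auto simp: T_def)
  have dis: "disjoint_family_on C J" unfolding C_def J_def by (rule disjoint_atoms)
  have C: "C s \<in> sets \<mu>" for s unfolding C_def by (rule sets_atom) (use fin \<B> in auto)
  have A_eq: "A = (\<Union>s\<in>T A. C s)" if "A \<in> \<B>" for A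
    unfolding T_def C_def J_def by (rule union_atoms) (use that \<B>(1)[THEN sets.sets_into_space] in auto)
  have C_finite: "emeasure \<mu> (C s) < \<infinity>" if s: "s \<in> J" for s
  proof -
    obtain A where A: "A \<in> s" "A \<in> \<B>" using s by (auto simp: J_def)
    then have "C s \<subseteq> A" by (auto simp: C_def atom_def)
    then show ?thesis using emeasure_mono[of "C s" A \<mu>] \<B> A by (auto intro: order.strict_trans1)
  qed
  define N where "N \<omega> = (\<lambda>s\<in>J. point_count \<omega> (C s))" for \<omega> :: "'z measure"
  define total where "total k A = (\<Sum>s\<in>T A. real (k s))" for k :: "'z set set \<Rightarrow> nat" and A
  define p where "p k = ennreal (\<Prod>s\<in>J. poisson_weight (measure \<mu> (C s)) (k s))"
    for k :: "'z set set \<Rightarrow> nat"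
  have law: "(\<integral>\<^sup>+\<omega>. H (N \<omega>) \<partial>P) = (\<integral>\<^sup>+k. H k * p k \<partial>count_space (J \<rightarrow>\<^sub>E UNIV))" for H
    unfolding N_def p_def by (rule nn_integral_counts[OF J dis C C_finite])
  have "AE \<omega> in P. \<forall>s\<in>J. emeasure \<omega> (C s) = of_nat (point_count \<omega> (C s))"
    using J C C_finite by (intro AE_finite_allI AE_count) auto
  then have ae: "AE \<omega> in P. \<forall>A\<in>\<B>. measure \<omega> A = total (N \<omega>) A"
    using AE_space
  proof eventually_elim
    case (elim \<omega>)
    show ?case
    proof
      fix A assume A: "A \<in> \<B>"
      have "measure \<omega> A = measure \<omega> (\<Union>s\<in>T A. C s)" using A_eq[OF A] by simp
      also have "\<dots> = (\<Sum>s\<in>T A. measure \<omega> (C s))"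
      proof (rule measure_finite_Union)
        show "disjoint_family_on C (T A)" using T(2) dis by (rule disjoint_family_on_mono)
        show "C ` T A \<subseteq> sets \<omega>" using C sets_point_measure[OF elim(2)] by auto
        show "emeasure \<omega> (C s) \<noteq> \<infinity>" if "s \<in> T A" for s
        proof -
          have "s \<in> J" using that T by auto
          then show ?thesis using elim(1) by (metis ennreal_of_nat_neq_top infinity_ennreal_def)
        qed
      qed (rule T)
      also have "\<dots> = total (N \<omega>) A"
        unfolding total_def
      proof (rule sum.cong[OF refl])
        fix s assume "s \<in> T A"
        then have "s \<in> J" using T by auto
        then show "measure \<omega> (C s) = real (N \<omega> s)"
          using measure_eq_count[of \<omega> "C s"] bspec[OF elim(1), of s] by (simp add: N_def)
      qed
      finally show "measure \<omega> A = total (N \<omega>) A" .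
    qed
  qed
  have step: "add_point z (measure \<omega>) A = total ((N \<omega>)(t := Suc (N \<omega> t))) A"
    if "measure \<omega> A = total (N \<omega>) A" "z \<in> C t" "t \<in> J" "A \<in> \<B>" for z t \<omega> A
  proof (cases "A \<in> t")
    case True
    have "t \<in> T A" using True that by (simp add: T_def)
    moreover have "z \<in> A" using that True by (auto simp: C_def atom_def)
    ultimately show ?thesis
      using T(1) that(1) by (simp add: total_def add_point_def sum.remove[of "T A" t])
  next
    case False
    then have "total ((N \<omega>)(t := Suc (N \<omega> t))) A = total (N \<omega>) A"
      unfolding total_def by (intro sum.cong) (auto simp: T_def)
    moreover have "z \<notin> A" using that False by (auto simp: C_def atom_def)
    ultimately show ?thesis using that(1) by (simp add: add_point_def)
  qed
  define v where "v t = (\<integral>\<^sup>+k. G (total (k(t := Suc (k t)))) * p k \<partial>count_space (J \<rightarrow>\<^sub>E UNIV))" for t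
  have v: "(\<integral>\<^sup>+\<omega>. G (add_point z (measure \<omega>)) \<partial>P) = v t" if "z \<in> C t" "t \<in> J" for z t
  proof -
    have "(\<integral>\<^sup>+\<omega>. G (add_point z (measure \<omega>)) \<partial>P)
        = (\<integral>\<^sup>+\<omega>. G (total ((N \<omega>)(t := Suc (N \<omega> t)))) \<partial>P)"
    proof (rule nn_integral_cong_AE, use ae in eventually_elim)
      fix \<omega> assume "\<forall>A\<in>\<B>. measure \<omega> A = total (N \<omega>) A"
      then show "G (add_point z (measure \<omega>)) = G (total ((N \<omega>)(t := Suc (N \<omega> t))))"
        using G step that unfolding depends_on_def by blast
    qed
    also have "\<dots> = v t" unfolding v_def by (rule law)
    finally show ?thesis .
  qed
  have "(\<integral>\<^sup>+\<omega>. ennreal (measure \<omega> B) * G (measure \<omega>) \<partial>P)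
      = (\<integral>\<^sup>+\<omega>. (\<Sum>t\<in>T B. of_nat (N \<omega> t)) * G (total (N \<omega>)) \<partial>P)"
  proof (rule nn_integral_cong_AE, use ae in eventually_elim)
    fix \<omega> assume a: "\<forall>A\<in>\<B>. measure \<omega> A = total (N \<omega>) A"
    then have "ennreal (measure \<omega> B) = (\<Sum>t\<in>T B. of_nat (N \<omega> t))"
      using B by (simp add: total_def ennreal_of_nat_eq_real_of_nat)
    moreover have "G (measure \<omega>) = G (total (N \<omega>))"
      using a G unfolding depends_on_def by blast
    ultimately show "ennreal (measure \<omega> B) * G (measure \<omega>)
        = (\<Sum>t\<in>T B. of_nat (N \<omega> t)) * G (total (N \<omega>))" by simp
  qed
  also have "\<dots> = (\<integral>\<^sup>+k. (\<Sum>t\<in>T B. of_nat (k t) * G (total k) * p k) \<partial>count_space (J \<rightarrow>\<^sub>E UNIV))"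
    by (subst law) (simp add: sum_distrib_right)
  also have "\<dots> = (\<Sum>t\<in>T B. \<integral>\<^sup>+k. of_nat (k t) * G (total k) * p k \<partial>count_space (J \<rightarrow>\<^sub>E UNIV))"
    by (rule nn_integral_sum) simp
  also have "\<dots> = (\<Sum>t\<in>T B. v t * emeasure \<mu> (C t))"
  proof (rule sum.cong[OF refl])
    fix t assume "t \<in> T B"
    then have t: "t \<in> J" using T by auto
    have "(\<integral>\<^sup>+k. of_nat (k t) * G (total k) * p k \<partial>count_space (J \<rightarrow>\<^sub>E UNIV))
        = ennreal (measure \<mu> (C t)) * v t"
      unfolding p_def v_def by (rule nn_integral_poisson_weights_shift[OF J t]) simp
    then show "(\<integral>\<^sup>+k. of_nat (k t) * G (total k) * p k \<partial>count_space (J \<rightarrow>\<^sub>E UNIV))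
        = v t * emeasure \<mu> (C t)"
      using C_finite[OF t] by (simp add: emeasure_eq_ennreal_measure mult.commute)
  qed
  also have "\<dots> = (\<integral>\<^sup>+z. (\<Sum>t\<in>T B. v t * indicator (C t) z) \<partial>\<mu>)"
    using C by (subst nn_integral_sum) (auto simp: nn_integral_cmult_indicator)
  also have "\<dots> = (\<integral>\<^sup>+z. indicator B z * (\<integral>\<^sup>+\<omega>. G (add_point z (measure \<omega>)) \<partial>P) \<partial>\<mu>)"
  proof (rule nn_integral_cong)
    fix z
    show "(\<Sum>t\<in>T B. v t * indicator (C t) z)
        = indicator B z * (\<integral>\<^sup>+\<omega>. G (add_point z (measure \<omega>)) \<partial>P)"
    proof (cases "z \<in> B")
      case True
      then obtain s where s: "s \<in> T B" "z \<in> C s" using A_eq[OF B] by auto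
      have unique: "t = s" if "t \<in> T B" "z \<in> C t" for t
        using disjoint_family_onD[OF dis, of t s] that s T(2)[of B] by blast
      have "v t * indicator (C t) z = (if t = s then v s else 0)" if t: "t \<in> T B" for t
      proof (cases "z \<in> C t")
        case True
        then show ?thesis using unique[OF t True] by simp
      next
        case False
        then have "t \<noteq> s" using s(2) by blast
        then show ?thesis using False by simp
      qed
      then have "(\<Sum>t\<in>T B. v t * indicator (C t) z) = v s"
        using s T(1)[of B] by (simp add: sum.delta cong: sum.cong)
      also have "\<dots> = (\<integral>\<^sup>+\<omega>. G (add_point z (measure \<omega>)) \<partial>P)"
        using s T(2)[of B] by (intro v[symmetric]) auto
      finally show ?thesis using True by simp
    next
      case False
      then have "z \<notin> C t" if "t \<in> T B" for t using A_eq[OF B] that by auto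
      then show ?thesis using False by simp
    qed
  qed
  finally show ?thesis .
qed

section \<open>Moments and the signed Mecke formula\<close>

sublocale poisson_space \<subseteq> pair: pair_sigma_finite \<mu> P ..

text \<open>
  A class of random variables that is closed under sums and products, in order that polynomials in the
  counts are integrable without any bookkeeping of exponents.
\<close>

definition all_moments :: "'a measure \<Rightarrow> ('a \<Rightarrow> real) \<Rightarrow> bool" where
  "all_moments M X \<longleftrightarrow> X \<in> borel_measurable M \<and> (\<forall>p::nat. integrable M (\<lambda>\<omega>. \<bar>X \<omega>\<bar> ^ p))"

lemma all_moments_measurable: "all_moments M X \<Longrightarrow> X \<in> borel_measurable M"
  by (simp add: all_moments_def)

lemma all_moments_integrable: "all_moments M X \<Longrightarrow> integrable M X"
  unfolding all_moments_def
  by (metis (no_types, lifting) Bochner_Integration.integrable_cong integrable_abs_cancel power_one_right)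

lemma all_moments_square: "all_moments M X \<Longrightarrow> integrable M (\<lambda>\<omega>. (X \<omega>)\<^sup>2)"
  unfolding all_moments_def by (metis (no_types, lifting) Bochner_Integration.integrable_cong power2_abs)

lemma (in finite_measure) all_moments_const [simp]: "all_moments M (\<lambda>_. c)"
  by (simp add: all_moments_def)

lemma all_moments_mult:
  assumes "all_moments M X" "all_moments M Y"
  shows "all_moments M (\<lambda>\<omega>. X \<omega> * Y \<omega>)"
  unfolding all_moments_def
proof (intro conjI allI)
  have [measurable]: "X \<in> borel_measurable M" "Y \<in> borel_measurable M"
    using assms by (auto simp: all_moments_def)
  show "(\<lambda>\<omega>. X \<omega> * Y \<omega>) \<in> borel_measurable M" by measurable
  fix p :: nat
  have bound: "\<bar>x * y\<bar> ^ p \<le> \<bar>x\<bar> ^ (2 * p) + \<bar>y\<bar> ^ (2 * p)" for x y :: real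
  proof -
    have "2 * (\<bar>x\<bar> ^ p) * (\<bar>y\<bar> ^ p) \<le> (\<bar>x\<bar> ^ p)\<^sup>2 + (\<bar>y\<bar> ^ p)\<^sup>2" by (rule sum_squares_bound)
    moreover have "0 \<le> \<bar>x\<bar> ^ p * \<bar>y\<bar> ^ p" by simp
    ultimately have "\<bar>x\<bar> ^ p * \<bar>y\<bar> ^ p \<le> (\<bar>x\<bar> ^ p)\<^sup>2 + (\<bar>y\<bar> ^ p)\<^sup>2" by linarith
    then show ?thesis
      by (simp add: abs_mult power_mult_distrib flip: power_mult) (simp add: mult.commute)
  qed
  show "integrable M (\<lambda>\<omega>. \<bar>X \<omega> * Y \<omega>\<bar> ^ p)"
    by (rule Bochner_Integration.integrable_bound[of M "\<lambda>\<omega>. \<bar>X \<omega>\<bar> ^ (2 * p) + \<bar>Y \<omega>\<bar> ^ (2 * p)"])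
      (use assms bound in \<open>auto simp: all_moments_def\<close>)
qed

lemma all_moments_add:
  assumes "all_moments M X" "all_moments M Y"
  shows "all_moments M (\<lambda>\<omega>. X \<omega> + Y \<omega>)"
  unfolding all_moments_def
proof (intro conjI allI)
  have [measurable]: "X \<in> borel_measurable M" "Y \<in> borel_measurable M"
    using assms by (auto simp: all_moments_def)
  show "(\<lambda>\<omega>. X \<omega> + Y \<omega>) \<in> borel_measurable M" by measurable
  fix p :: nat
  have bound: "\<bar>x + y\<bar> ^ p \<le> 2 ^ p * (\<bar>x\<bar> ^ p + \<bar>y\<bar> ^ p)" for x y :: real
  proof -
    have "\<bar>x + y\<bar> ^ p \<le> (2 * max \<bar>x\<bar> \<bar>y\<bar>) ^ p" by (rule power_mono) auto
    also have "\<dots> \<le> 2 ^ p * (\<bar>x\<bar> ^ p + \<bar>y\<bar> ^ p)"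
      unfolding power_mult_distrib by (intro mult_left_mono) (auto simp: max_def)
    finally show ?thesis .
  qed
  show "integrable M (\<lambda>\<omega>. \<bar>X \<omega> + Y \<omega>\<bar> ^ p)"
    by (rule Bochner_Integration.integrable_bound[of M "\<lambda>\<omega>. 2 ^ p * (\<bar>X \<omega>\<bar> ^ p + \<bar>Y \<omega>\<bar> ^ p)"])
      (use assms bound in \<open>auto simp: all_moments_def\<close>)
qed

lemma (in finite_measure) all_moments_diff:
  assumes "all_moments M X" "all_moments M Y"
  shows "all_moments M (\<lambda>\<omega>. X \<omega> - Y \<omega>)"
  using all_moments_add[OF assms(1) all_moments_mult[OF all_moments_const assms(2)], of "-1"]
  by simp

lemma (in finite_measure) all_moments_sum:
  assumes "\<And>i. i \<in> I \<Longrightarrow> all_moments M (X i)"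
  shows "all_moments M (\<lambda>\<omega>. \<Sum>i\<in>I. X i \<omega>)"
  using assms by (induction I rule: infinite_finite_induct) (auto intro: all_moments_add)

lemma (in finite_measure) all_moments_prod:
  assumes "\<And>i. i \<in> I \<Longrightarrow> all_moments M (X i)"
  shows "all_moments M (\<lambda>\<omega>. \<Prod>i\<in>I. X i \<omega>)"
  using assms by (induction I rule: infinite_finite_induct) (auto intro: all_moments_mult)

text \<open>
  By induction on the exponent: the Mecke formula turns \<open>E[\<omega>(B)\<^sup>p\<^sup>+\<^sup>1]\<close> into
  \<open>\<mu>(B) E[(\<omega>(B) + 1)\<^sup>p]\<close>.
\<close>

lemma (in poisson_space) all_moments_evaluation:
  assumes B: "B \<in> sets \<mu>" "emeasure \<mu> B < \<infinity>"
  shows "all_moments P (\<lambda>\<omega>. measure \<omega> B)"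
proof -
  note [measurable] = B(1)
  have fin: "(\<integral>\<^sup>+\<omega>. ennreal (measure \<omega> B ^ p) \<partial>P) < \<infinity>" for p :: nat
  proof (induction p)
    case 0
    then show ?case by (simp add: P.emeasure_space_1)
  next
    case (Suc p)
    have bound: "(x + indicator B z) ^ p \<le> 2 ^ p * (x ^ p + 1)" if "0 \<le> x" for x :: real and z
    proof -
      have "(x + indicator B z) ^ p \<le> (2 * max x 1) ^ p"
        using that by (intro power_mono) (auto simp: indicator_def)
      also have "\<dots> \<le> 2 ^ p * (x ^ p + 1)"
        using that unfolding power_mult_distrib by (intro mult_left_mono) (auto simp: max_def)
      finally show ?thesis .
    qed
    let ?K = "\<integral>\<^sup>+\<omega>. ennreal (2 ^ p) * (ennreal (measure \<omega> B ^ p) + 1) \<partial>P"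
    have "?K = ennreal (2 ^ p) * ((\<integral>\<^sup>+\<omega>. ennreal (measure \<omega> B ^ p) \<partial>P) + 1)"
      by (subst nn_integral_cmult) (auto simp: nn_integral_add P.emeasure_space_1)
    then have K: "?K < \<infinity>" using Suc.IH by (auto simp: ennreal_mult_less_top)
    have "(\<integral>\<^sup>+\<omega>. ennreal (measure \<omega> B ^ Suc p) \<partial>P)
        = (\<integral>\<^sup>+\<omega>. ennreal (measure \<omega> B) * ennreal (measure \<omega> B ^ p) \<partial>P)"
      by (simp add: ennreal_mult)
    also have "\<dots> = (\<integral>\<^sup>+z. indicator B z *
        (\<integral>\<^sup>+\<omega>. ennreal ((add_point z (measure \<omega>) B) ^ p) \<partial>P) \<partial>\<mu>)"
      by (rule mecke_cylinder[where \<B>="{B}" and G="\<lambda>c. ennreal (c B ^ p)"])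
        (use B in \<open>auto simp: depends_on_def\<close>)
    also have "\<dots> \<le> (\<integral>\<^sup>+z. indicator B z * ?K \<partial>\<mu>)"
    proof (intro nn_integral_mono mult_left_mono)
      fix z \<omega>
      show "ennreal ((add_point z (measure \<omega>) B) ^ p)
          \<le> ennreal (2 ^ p) * (ennreal (measure \<omega> B ^ p) + 1)"
        using bound[of "measure \<omega> B" z]
        by (simp add: add_point_def flip: ennreal_1 ennreal_plus ennreal_mult)
    qed auto
    also have "\<dots> = emeasure \<mu> B * ?K" by (subst nn_integral_multc) auto
    also have "\<dots> < \<infinity>" using K B by (auto simp: ennreal_mult_less_top)
    finally show ?case .
  qed
  then show ?thesis
    unfolding all_moments_def by (auto intro!: integrableI_nonneg)
qed

text \<open>
  The positive and the negative part of \<open>G\<close> separately.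
\<close>

lemma (in poisson_space) mecke_cylinder_integral:
  fixes G :: "('z set \<Rightarrow> real) \<Rightarrow> real"
  assumes fin: "finite \<B>"
    and \<B>: "\<And>A. A \<in> \<B> \<Longrightarrow> A \<in> sets \<mu>" "\<And>A. A \<in> \<B> \<Longrightarrow> emeasure \<mu> A < \<infinity>"
    and B: "B \<in> \<B>"
    and G: "depends_on \<B> G"
    and joint[measurable]: "(\<lambda>(z, \<omega>). G (add_point z (measure \<omega>))) \<in> borel_measurable (\<mu> \<Otimes>\<^sub>M P)"
    and int: "integrable P (\<lambda>\<omega>. measure \<omega> B * G (measure \<omega>))"
  shows "integrable (\<mu> \<Otimes>\<^sub>M P) (\<lambda>(z, \<omega>). indicator B z * G (add_point z (measure \<omega>)))"
    and "(LINT (z, \<omega>)|(\<mu> \<Otimes>\<^sub>M P). indicator B z * G (add_point z (measure \<omega>)))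
      = (LINT \<omega>|P. measure \<omega> B * G (measure \<omega>))"
proof -
  have [measurable]: "B \<in> sets \<mu>" by (rule \<B>(1)[OF B])
  have eq: "(\<integral>\<^sup>+\<omega>. ennreal (s * (measure \<omega> B * G (measure \<omega>))) \<partial>P)
      = (\<integral>\<^sup>+x. ennreal (s * (case x of (z, \<omega>) \<Rightarrow> indicator B z * G (add_point z (measure \<omega>))))
          \<partial>(\<mu> \<Otimes>\<^sub>M P))" for s :: real
  proof -
    have "(\<integral>\<^sup>+\<omega>. ennreal (s * (measure \<omega> B * G (measure \<omega>))) \<partial>P)
        = (\<integral>\<^sup>+\<omega>. ennreal (measure \<omega> B) * ennreal (s * G (measure \<omega>)) \<partial>P)"
      by (intro nn_integral_cong) (simp add: ennreal_mult'[symmetric] mult_ac)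
    also have "\<dots> = (\<integral>\<^sup>+z. indicator B z *
        (\<integral>\<^sup>+\<omega>. ennreal (s * G (add_point z (measure \<omega>))) \<partial>P) \<partial>\<mu>)"
      by (rule mecke_cylinder[OF fin \<B> B]) (use G in \<open>auto simp: depends_on_def\<close>, metis)
    also have "\<dots> = (\<integral>\<^sup>+z. \<integral>\<^sup>+\<omega>. ennreal (s * (case (z, \<omega>) of (z, \<omega>) \<Rightarrow>
        indicator B z * G (add_point z (measure \<omega>)))) \<partial>P \<partial>\<mu>)"
      by (intro nn_integral_cong) (auto simp: indicator_def)
    also have "\<dots> = (\<integral>\<^sup>+x. ennreal (s * (case x of (z, \<omega>) \<Rightarrow>
        indicator B z * G (add_point z (measure \<omega>)))) \<partial>(\<mu> \<Otimes>\<^sub>M P))"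
      by (rule P.nn_integral_fst) measurable
    finally show ?thesis .
  qed
  show int': "integrable (\<mu> \<Otimes>\<^sub>M P) (\<lambda>(z, \<omega>). indicator B z * G (add_point z (measure \<omega>)))"
    using int eq[of 1] eq[of "-1"] by (simp add: real_integrable_def)
  show "(LINT (z, \<omega>)|(\<mu> \<Otimes>\<^sub>M P). indicator B z * G (add_point z (measure \<omega>)))
      = (LINT \<omega>|P. measure \<omega> B * G (measure \<omega>))"
    using eq[of 1] eq[of "-1"]
    by (simp add: real_lebesgue_integral_def[OF int'] real_lebesgue_integral_def[OF int])
qed

section \<open>Inserting a coordinate\<close>

text \<open>
  The enumeration of the naturals without \<open>i\<close>; it names the coordinates that are left when the
  \<open>i\<close>-th one is split off.
\<close>

definition skip :: "nat \<Rightarrow> nat \<Rightarrow> nat" where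
  "skip i j = (if j < i then j else Suc j)"

text \<open>
  The arguments outside of \<open>{..<p}\<close> move to arguments outside of \<open>{..<Suc p}\<close>, where a point of the
  power space has to be \<^const>\<open>undefined\<close>.
\<close>

definition insert_coord :: "nat \<Rightarrow> 'z \<Rightarrow> (nat \<Rightarrow> 'z) \<Rightarrow> nat \<Rightarrow> 'z" where
  "insert_coord i z x = (\<lambda>j. if j < i then x j else if j = i then z else x (j - 1))"

lemma skip_neq [simp]: "skip i j \<noteq> i" "i \<noteq> skip i j"
  by (auto simp: skip_def)

lemma inj_skip: "inj (skip i)"
  by (auto simp: inj_def skip_def split: if_splits)

lemma lessThan_Suc_skip: "i \<le> p \<Longrightarrow> {..<Suc p} = insert i (skip i ` {..<p})"
proof (intro set_eqI iffI)
  fix j assume "i \<le> p" "j \<in> {..<Suc p}"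
  then show "j \<in> insert i (skip i ` {..<p})"
    by (cases j i rule: linorder_cases)
      (auto simp: skip_def image_iff intro: bexI[of _ j] bexI[of _ "j - 1"])
qed (auto simp: skip_def split: if_splits)

lemma prod_skip:
  fixes f :: "nat \<Rightarrow> 'a::comm_monoid_mult"
  assumes "i \<le> p"
  shows "(\<Prod>j<Suc p. f j) = f i * (\<Prod>j<p. f (skip i j))"
  unfolding lessThan_Suc_skip[OF assms]
  by (subst prod.insert) (auto simp: prod.reindex inj_on_subset[OF inj_skip])

lemma insert_coord_same [simp]: "insert_coord i z x i = z"
  and insert_coord_skip [simp]: "insert_coord i z x (skip i j) = x j"
  by (auto simp: insert_coord_def skip_def)

lemma insert_coord_0: "insert_coord 0 z x = case_nat z x"
  by (auto simp: insert_coord_def fun_eq_iff split: nat.split)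

lemma insert_coord_PiE_iff:
  assumes "i \<le> p" "x \<in> extensional {..<p}"
  shows "insert_coord i z x \<in> PiE {..<Suc p} B \<longleftrightarrow>
    z \<in> B i \<and> x \<in> PiE {..<p} (\<lambda>j. B (skip i j))"
proof -
  have "insert_coord i z x \<in> extensional {..<Suc p}"
    using assms by (auto simp: extensional_def insert_coord_def)
  then have "insert_coord i z x \<in> PiE {..<Suc p} B \<longleftrightarrow> (\<forall>j\<in>{..<Suc p}. insert_coord i z x j \<in> B j)"
    by (auto simp: PiE_def)
  also have "\<dots> \<longleftrightarrow> z \<in> B i \<and> (\<forall>j\<in>{..<p}. x j \<in> B (skip i j))"
    unfolding lessThan_Suc_skip[OF assms(1)] by simp
  finally show ?thesis using assms by (auto simp: PiE_def)
qed

lemma measurable_insert_coord [measurable]: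
  assumes "i \<le> p"
  shows "(\<lambda>(z, x). insert_coord i z x) \<in> M \<Otimes>\<^sub>M power_measure M p \<rightarrow>\<^sub>M power_measure M (Suc p)"
proof -
  have "(\<lambda>w. insert_coord i (fst w) (snd w)) \<in> M \<Otimes>\<^sub>M power_measure M p \<rightarrow>\<^sub>M power_measure M (Suc p)"
    unfolding insert_coord_def
  proof (rule measurable_PiM_single')
    fix j assume "j \<in> {..<Suc p}"
    then have "j < i \<Longrightarrow> j < p" "i < j \<Longrightarrow> j - 1 < p" using assms by auto
    then show "(\<lambda>w. if j < i then snd w j else if j = i then fst w else snd w (j - 1))
        \<in> M \<Otimes>\<^sub>M power_measure M p \<rightarrow>\<^sub>M M"
      by (cases j i rule: linorder_cases) auto
  next
    have in_space: "insert_coord i z x \<in> PiE {..<Suc p} (\<lambda>_. space M)"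
      if "z \<in> space M" "x \<in> PiE {..<p} (\<lambda>_. space M)" for z x
      using that assms by (subst insert_coord_PiE_iff) (auto simp: PiE_def)
    show "(\<lambda>w j. if j < i then snd w j else if j = i then fst w else snd w (j - 1))
        \<in> space (M \<Otimes>\<^sub>M power_measure M p) \<rightarrow> (\<Pi>\<^sub>E i\<in>{..<Suc p}. space M)"
    proof (rule Pi_I)
      fix w assume "w \<in> space (M \<Otimes>\<^sub>M power_measure M p)"
      then have "fst w \<in> space M" "snd w \<in> PiE {..<p} (\<lambda>_. space M)"
        by (simp_all add: space_pair_measure space_PiM mem_Times_iff del: PiE_iff)
      then show "(\<lambda>j. if j < i then snd w j else if j = i then fst w else snd w (j - 1))
          \<in> (\<Pi>\<^sub>E i\<in>{..<Suc p}. space M)"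
        by (rule in_space[unfolded insert_coord_def])
    qed
  qed
  then show ?thesis by (simp add: case_prod_beta')
qed

text \<open>
  Both measures agree on boxes, and boxes determine a \<open>\<sigma>\<close>-finite product measure.
\<close>

lemma (in sigma_finite_measure) distr_insert_coord:
  assumes i: "i \<le> p"
  shows "distr (M \<Otimes>\<^sub>M power_measure M p) (power_measure M (Suc p)) (\<lambda>(z, x). insert_coord i z x)
    = power_measure M (Suc p)"
proof -
  interpret product_sigma_finite "\<lambda>_::nat. M" ..
  interpret pow: sigma_finite_measure "power_measure M p" by (rule sigma_finite) simp
  note [measurable] = measurable_insert_coord[OF i, of M]
  show ?thesis
  proof (rule PiM_eqI)
    fix A :: "nat \<Rightarrow> 'a set"
    assume A: "\<And>j. j \<in> {..<Suc p} \<Longrightarrow> A j \<in> sets M"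
    have A': "A i \<in> sets M" "\<And>j. j < p \<Longrightarrow> A (skip i j) \<in> sets M"
      using A i by (auto simp: skip_def)
    have vim: "(\<lambda>(z, x). insert_coord i z x) -` PiE {..<Suc p} A \<inter> space (M \<Otimes>\<^sub>M power_measure M p)
        = A i \<times> PiE {..<p} (\<lambda>j. A (skip i j))"
    proof (intro set_eqI)
      fix w :: "'a \<times> (nat \<Rightarrow> 'a)"
      obtain z x where w: "w = (z, x)" by (cases w)
      have "A i \<subseteq> space M" "\<And>j. j < p \<Longrightarrow> A (skip i j) \<subseteq> space M"
        using A' sets.sets_into_space by auto
      then have "z \<in> space M \<and> x \<in> PiE {..<p} (\<lambda>_. space M)"
        if "z \<in> A i" "x \<in> PiE {..<p} (\<lambda>j. A (skip i j))"
        using that by (auto simp: PiE_def Pi_def)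
      moreover have "insert_coord i z x \<in> PiE {..<Suc p} A \<longleftrightarrow>
          z \<in> A i \<and> x \<in> PiE {..<p} (\<lambda>j. A (skip i j))" if "x \<in> PiE {..<p} (\<lambda>_. space M)"
        using that i by (intro insert_coord_PiE_iff) (auto simp: PiE_def)
      ultimately show "w \<in> (\<lambda>(z, x). insert_coord i z x) -` PiE {..<Suc p} A
          \<inter> space (M \<Otimes>\<^sub>M power_measure M p) \<longleftrightarrow> w \<in> A i \<times> PiE {..<p} (\<lambda>j. A (skip i j))"
        unfolding w by (auto simp: space_pair_measure space_PiM simp del: PiE_iff)
    qed
    have "emeasure (distr (M \<Otimes>\<^sub>M power_measure M p) (power_measure M (Suc p))
        (\<lambda>(z, x). insert_coord i z x)) (PiE {..<Suc p} A)
        = emeasure (M \<Otimes>\<^sub>M power_measure M p) (A i \<times> PiE {..<p} (\<lambda>j. A (skip i j)))"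
      unfolding vim[symmetric] using A by (intro emeasure_distr sets_PiM_I_finite) auto
    also have "\<dots> = emeasure M (A i) * (\<Prod>j<p. emeasure M (A (skip i j)))"
      using A' emeasure_PiM[of "{..<p}" "\<lambda>j. A (skip i j)"]
      by (subst pow.emeasure_pair_measure_Times) (auto intro!: sets_PiM_I_finite)
    also have "\<dots> = (\<Prod>j<Suc p. emeasure M (A j))" by (rule prod_skip[OF i, symmetric])
    finally show "emeasure (distr (M \<Otimes>\<^sub>M power_measure M p) (power_measure M (Suc p))
        (\<lambda>(z, x). insert_coord i z x)) (PiE {..<Suc p} A) = (\<Prod>j<Suc p. emeasure M (A j))" .
  qed auto
qed

lemma (in sigma_finite_measure) nn_integral_insert_coord:
  assumes i: "i \<le> p" and [measurable]: "h \<in> borel_measurable (power_measure M (Suc p))"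
  shows "(\<integral>\<^sup>+z. \<integral>\<^sup>+x. h (insert_coord i z x) \<partial>power_measure M p \<partial>M)
    = (\<integral>\<^sup>+x. h x \<partial>power_measure M (Suc p))"
proof -
  interpret product_sigma_finite "\<lambda>_::nat. M" ..
  interpret pow: sigma_finite_measure "power_measure M p" by (rule sigma_finite) simp
  note [measurable] = measurable_insert_coord[OF i, of M]
  have "(\<integral>\<^sup>+x. h x \<partial>power_measure M (Suc p))
      = (\<integral>\<^sup>+w. h (case w of (z, x) \<Rightarrow> insert_coord i z x) \<partial>(M \<Otimes>\<^sub>M power_measure M p))"
    by (subst distr_insert_coord[OF i, symmetric], subst nn_integral_distr) auto
  also have "\<dots> = (\<integral>\<^sup>+z. \<integral>\<^sup>+x. h (insert_coord i z x) \<partial>power_measure M p \<partial>M)"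
    by (subst pow.nn_integral_fst[symmetric]) auto
  finally show ?thesis ..
qed

text \<open>
  By disjointness at most one of the sets contains \<open>z\<close>, so the expansion of the product stops after
  the terms of first order. This is why the difference operator lowers the order of an integral by one.
\<close>

lemma prod_add_indicator:
  fixes c :: "nat \<Rightarrow> real"
  assumes "disjoint_family_on A {..<Suc p}"
  shows "(\<Prod>i<Suc p. c i + indicator (A i) z)
    = (\<Prod>i<Suc p. c i) + (\<Sum>i<Suc p. indicator (A i) z * (\<Prod>j<p. c (skip i j)))"
proof (cases "\<exists>i<Suc p. z \<in> A i")
  case False
  then show ?thesis by (auto simp: indicator_def intro!: prod.cong)
next
  case True
  then obtain i where i: "i < Suc p" "z \<in> A i" by auto
  have other: "z \<notin> A j" if "j < Suc p" "j \<noteq> i" for j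
    using assms i that by (auto simp: disjoint_family_on_def)
  have "skip i j < Suc p" if "j < p" for j using that i by (auto simp: skip_def)
  then have "(\<Prod>j<Suc p. c j + indicator (A j) z) = (c i + 1) * (\<Prod>j<p. c (skip i j))"
    using i other by (subst prod_skip[of i]) (auto intro!: prod.cong)
  moreover have "(\<Sum>k<Suc p. indicator (A k) z * (\<Prod>j<p. c (skip k j)))
      = (\<Sum>k\<in>{i}. indicator (A k) z * (\<Prod>j<p. c (skip k j)))"
    using i other by (intro sum.mono_neutral_right) auto
  ultimately show ?thesis
    using i by (simp add: prod_skip[of i p c] algebra_simps del: prod.lessThan_Suc)
qed

section \<open>Integrals of step functions and the Ito inequality\<close>

text \<open>
  The data \<open>(N, a, A)\<close> of an elementary integrand are kept explicit. That the integral depends, up to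
  null sets, on the step function alone is a consequence of the Ito inequality below.
\<close>

definition step_integral ::
  "'z measure \<Rightarrow> nat \<Rightarrow> nat \<Rightarrow> (nat \<Rightarrow> real) \<Rightarrow> (nat \<Rightarrow> nat \<Rightarrow> 'z set) \<Rightarrow> ('z set \<Rightarrow> real) \<Rightarrow> real" where
  "step_integral \<mu> q N a A c = (\<Sum>l<N. a l * (\<Prod>i<q. c (A l i) - measure \<mu> (A l i)))"

definition step_kernel ::
  "nat \<Rightarrow> nat \<Rightarrow> (nat \<Rightarrow> real) \<Rightarrow> (nat \<Rightarrow> nat \<Rightarrow> 'z set) \<Rightarrow> (nat \<Rightarrow> 'z) \<Rightarrow> real" where
  "step_kernel q N a A x = (\<Sum>l<N. a l * indicator (PiE {..<q} (A l)) x)"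

definition step_boxes :: "'z measure \<Rightarrow> nat \<Rightarrow> nat \<Rightarrow> (nat \<Rightarrow> nat \<Rightarrow> 'z set) \<Rightarrow> bool" where
  "step_boxes \<mu> q N A \<longleftrightarrow> (\<forall>l<N. (\<forall>i<q. A l i \<in> sets \<mu> \<and> emeasure \<mu> (A l i) < \<infinity>) \<and>
     disjoint_family_on (A l) {..<q})"

text \<open>
  Fixing the \<open>i\<close>-th coordinate of a step function at \<open>z\<close> gives a step function of one variable less;
  this and the next definition are its data.
\<close>

definition slice_coeff :: "nat \<Rightarrow> 'z \<Rightarrow> (nat \<Rightarrow> real) \<Rightarrow> (nat \<Rightarrow> nat \<Rightarrow> 'z set) \<Rightarrow> nat \<Rightarrow> real" where
  "slice_coeff i z a A = (\<lambda>l. a l * indicator (A l i) z)"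

definition slice_boxes :: "nat \<Rightarrow> (nat \<Rightarrow> nat \<Rightarrow> 'z set) \<Rightarrow> nat \<Rightarrow> nat \<Rightarrow> 'z set" where
  "slice_boxes i A = (\<lambda>l j. A l (skip i j))"

lemma elementary_integral_iff:
  "elementary_integral \<mu> q f X \<longleftrightarrow> (\<exists>N a A. step_boxes \<mu> q N A \<and>
    f = step_kernel q N a A \<and> X = (\<lambda>\<omega>. step_integral \<mu> q N a A (measure \<omega>)))"
  unfolding elementary_integral_def step_boxes_def step_kernel_def[abs_def] step_integral_def ..

lemma step_boxes_slice:
  assumes "step_boxes \<mu> (Suc p) N A" "i \<le> p"
  shows "step_boxes \<mu> p N (slice_boxes i A)"
  unfolding step_boxes_def slice_boxes_def
proof (intro allI impI conjI)
  have s: "skip i j < Suc p" if "j < p" for j using that by (auto simp: skip_def)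
  fix l assume l: "l < N"
  show "A l (skip i j) \<in> sets \<mu>" "emeasure \<mu> (A l (skip i j)) < \<infinity>" if "j < p" for j
    using assms l s[OF that] by (auto simp: step_boxes_def)
  show "disjoint_family_on (\<lambda>j. A l (skip i j)) {..<p}"
    unfolding disjoint_family_on_def
  proof (intro ballI impI)
    fix j k assume "j \<in> {..<p}" "k \<in> {..<p}" "j \<noteq> k"
    then have "skip i j \<noteq> skip i k" "skip i j < Suc p" "skip i k < Suc p"
      using s inj_skip[of i] by (auto dest: injD)
    moreover have "disjoint_family_on (A l) {..<Suc p}"
      using assms(1) l by (simp add: step_boxes_def)
    ultimately show "A l (skip i j) \<inter> A l (skip i k) = {}"
      by (intro disjoint_family_onD[of "A l"]) auto
  qed
qed

lemma step_kernel_insert_coord: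
  assumes "i \<le> p" "x \<in> extensional {..<p}"
  shows "step_kernel (Suc p) N a A (insert_coord i z x)
    = step_kernel p N (slice_coeff i z a A) (slice_boxes i A) x"
  using insert_coord_PiE_iff[OF assms]
  by (auto simp: step_kernel_def slice_coeff_def slice_boxes_def indicator_def intro!: sum.cong)

text \<open>
  The difference operator at \<open>z\<close> turns the integral of a step function into the sum of the integrals
  of its slices at \<open>z\<close>, one for each position. All positions are present because the step function is
  not assumed to be symmetric.
\<close>

lemma step_integral_add_point:
  assumes "step_boxes \<mu> (Suc p) N A"
  shows "step_integral \<mu> (Suc p) N a A (add_point z c) = step_integral \<mu> (Suc p) N a A c
    + (\<Sum>i<Suc p. step_integral \<mu> p N (slice_coeff i z a A) (slice_boxes i A) c)"
proof -
  have "step_integral \<mu> (Suc p) N a A (add_point z c)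
      = (\<Sum>l<N. a l * (\<Prod>i<Suc p. (c (A l i) - measure \<mu> (A l i)) + indicator (A l i) z))"
    by (simp add: step_integral_def add_point_def algebra_simps del: prod.lessThan_Suc)
  also have "\<dots> = (\<Sum>l<N. a l * ((\<Prod>i<Suc p. c (A l i) - measure \<mu> (A l i))
      + (\<Sum>i<Suc p. indicator (A l i) z
          * (\<Prod>j<p. c (A l (skip i j)) - measure \<mu> (A l (skip i j))))))"
    using assms by (intro sum.cong refl arg_cong2[where f="(*)"] prod_add_indicator)
      (auto simp: step_boxes_def)
  also have "\<dots> = step_integral \<mu> (Suc p) N a A c
    + (\<Sum>l<N. \<Sum>i<Suc p. a l * indicator (A l i) z
          * (\<Prod>j<p. c (A l (skip i j)) - measure \<mu> (A l (skip i j))))"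
    by (simp only: step_integral_def distrib_left sum.distrib sum_distrib_left mult.assoc)
  also have "(\<Sum>l<N. \<Sum>i<Suc p. a l * indicator (A l i) z
          * (\<Prod>j<p. c (A l (skip i j)) - measure \<mu> (A l (skip i j))))
      = (\<Sum>i<Suc p. step_integral \<mu> p N (slice_coeff i z a A) (slice_boxes i A) c)"
    unfolding step_integral_def slice_coeff_def slice_boxes_def by (rule sum.swap)
  finally show ?thesis .
qed

lemma (in poisson_space) integral_pair_product:
  fixes f :: "'z \<Rightarrow> real" and g :: "'z measure \<Rightarrow> real"
  assumes f: "integrable \<mu> f" and g: "integrable P g"
  shows "integrable (\<mu> \<Otimes>\<^sub>M P) (\<lambda>(z, \<omega>). f z * g \<omega>)"
    and "(LINT (z, \<omega>)|(\<mu> \<Otimes>\<^sub>M P). f z * g \<omega>) = (LINT z|\<mu>. f z) * (LINT \<omega>|P. g \<omega>)"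
proof -
  note [measurable] = borel_measurable_integrable[OF f] borel_measurable_integrable[OF g]
  show int: "integrable (\<mu> \<Otimes>\<^sub>M P) (\<lambda>(z, \<omega>). f z * g \<omega>)"
    by (rule pair.Fubini_integrable) (use f g in \<open>auto simp: abs_mult\<close>)
  show "(LINT (z, \<omega>)|(\<mu> \<Otimes>\<^sub>M P). f z * g \<omega>) = (LINT z|\<mu>. f z) * (LINT \<omega>|P. g \<omega>)"
    by (subst pair.integral_fst'[OF int, symmetric]) simp
qed

lemma step_kernel_measurable:
  assumes "step_boxes \<mu> q N A"
  shows "step_kernel q N a A \<in> borel_measurable (power_measure \<mu> q)"
proof -
  have "PiE {..<q} (A l) \<in> sets (power_measure \<mu> q)" if "l < N" for l
    using assms that by (intro sets_PiM_I_finite) (auto simp: step_boxes_def)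
  then show ?thesis unfolding step_kernel_def[abs_def]
    by (intro borel_measurable_sum borel_measurable_times) auto
qed

lemma depends_on_step_integral:
  "depends_on ((\<lambda>(l, i). A l i) ` ({..<N} \<times> {..<q})) (step_integral \<mu> q N a A)"
  unfolding depends_on_def
proof (intro allI impI)
  fix c c' :: "'a set \<Rightarrow> real"
  assume "\<forall>B\<in>(\<lambda>(l, i). A l i) ` ({..<N} \<times> {..<q}). c B = c' B"
  then have "c (A l i) = c' (A l i)" if "l < N" "i < q" for l i using that by force
  then show "step_integral \<mu> q N a A c = step_integral \<mu> q N a A c'"
    by (simp add: step_integral_def)
qed

lemma (in poisson_space) all_moments_step_integral:
  assumes "step_boxes \<mu> q N A"
  shows "all_moments P (\<lambda>\<omega>. step_integral \<mu> q N a A (measure \<omega>))"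
  unfolding step_integral_def
  by (intro P.all_moments_sum all_moments_mult P.all_moments_const P.all_moments_prod P.all_moments_diff
      all_moments_evaluation) (use assms in \<open>auto simp: step_boxes_def\<close>)

lemma (in poisson_space) measurable_step_integral_slice:
  assumes A: "step_boxes \<mu> (Suc p) N A" and i: "i < Suc p"
  shows "(\<lambda>(z, \<omega>). step_integral \<mu> p N (slice_coeff i z a A) (slice_boxes i A) (measure \<omega>))
    \<in> borel_measurable (\<mu> \<Otimes>\<^sub>M P)"
proof -
  have s: "skip i j < Suc p" if "j < p" for j using that by (auto simp: skip_def)
  have "(\<lambda>(z, \<omega>). a l * indicator (A l i) z *
      (\<Prod>j<p. measure \<omega> (A l (skip i j)) - measure \<mu> (A l (skip i j)))) \<in> borel_measurable (\<mu> \<Otimes>\<^sub>M P)"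
    if l: "l < N" for l
  proof -
    have [measurable]: "A l i \<in> sets \<mu>" using A i l by (simp add: step_boxes_def)
    have [measurable]: "(\<lambda>\<omega>. \<Prod>j<p. measure \<omega> (A l (skip i j)) - measure \<mu> (A l (skip i j)))
        \<in> borel_measurable P"
      by (intro borel_measurable_prod borel_measurable_diff measurable_measure_evaluation
          borel_measurable_const) (use A l s in \<open>auto simp: step_boxes_def\<close>)
    show ?thesis by measurable
  qed
  then show ?thesis
    unfolding step_integral_def slice_coeff_def slice_boxes_def case_prod_beta'
    by (intro borel_measurable_sum) auto
qed

text \<open>
  For \<open>X = I\<^sub>q(f)\<close> with \<open>q = p + 1\<close>, expand one factor \<open>X\<close> along the first coordinate of the boxes and
  apply the Mecke formula to that coordinate. Adding a point in \<open>A\<^sub>l\<^sub>,\<^sub>0\<close> does not change the remaining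
  factors of the box, so
  \<open>E[X\<^sup>2] = \<integral> E[I\<^sub>p(f\<^sub>0\<^sup>z) \<Sum>\<^sub>i I\<^sub>p(f\<^sub>i\<^sup>z)] \<mu>(dz)\<close>
  with \<open>f\<^sub>i\<^sup>z\<close> the slice of \<open>f\<close> at position \<open>i\<close>. Estimate the products by half the sum of the squares
  and use the induction hypothesis: by Fubini each of the \<open>q\<close> positions contributes at most
  \<open>p! \<parallel>f\<parallel>\<^sup>2\<close>.
\<close>

lemma (in poisson_space) ito_inequality:
  assumes "step_boxes \<mu> q N A"
  shows "(\<integral>\<^sup>+\<omega>. ennreal ((step_integral \<mu> q N a A (measure \<omega>))\<^sup>2) \<partial>P)
    \<le> ennreal (fact q) * (\<integral>\<^sup>+x. ennreal ((step_kernel q N a A x)\<^sup>2) \<partial>power_measure \<mu> q)"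
  using assms
proof (induction q arbitrary: a A)
  case 0
  show ?case by (simp add: step_integral_def step_kernel_def PiM_empty P.emeasure_space_1
        nn_integral_count_space_finite lessThan_def)
next
  case (Suc p)
  note A = Suc.prems
  define X where "X = step_integral \<mu> (Suc p) N a A"
  define Y where "Y l c = (\<Prod>j<p. c (A l (Suc j)) - measure \<mu> (A l (Suc j)))"
    for l and c :: "'z set \<Rightarrow> real"
  define D where "D i z \<omega> = step_integral \<mu> p N (slice_coeff i z a A) (slice_boxes i A) (measure \<omega>)"
    for i z \<omega>
  define \<B> where "\<B> = (\<lambda>(l, i). A l i) ` ({..<N} \<times> {..<Suc p})"
  have \<B>: "finite \<B>" "\<And>B. B \<in> \<B> \<Longrightarrow> B \<in> sets \<mu>" "\<And>B. B \<in> \<B> \<Longrightarrow> emeasure \<mu> B < \<infinity>"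
    using A by (auto simp: \<B>_def step_boxes_def)
  have inB: "A l i \<in> \<B>" if "l < N" "i < Suc p" for l i using that by (force simp: \<B>_def)
  have skip0: "skip 0 = Suc" by (auto simp: skip_def fun_eq_iff)
  have X_eq: "X c = (\<Sum>l<N. a l * ((c (A l 0) - measure \<mu> (A l 0)) * Y l c))" for c
    unfolding X_def step_integral_def Y_def by (simp only: prod_skip[of 0 p] le0 skip0)
  have D0_eq: "D 0 z \<omega> = (\<Sum>l<N. a l * (indicator (A l 0) z * Y l (measure \<omega>)))" for z \<omega>
    by (simp add: D_def Y_def step_integral_def slice_coeff_def slice_boxes_def skip0 mult.assoc)
  have Y_add: "Y l (add_point z c) = Y l c" if "l < N" "z \<in> A l 0" for l z c
  proof -
    have "z \<notin> A l (Suc j)" if "j < p" for j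
    proof -
      have "disjoint_family_on (A l) {..<Suc p}" using A \<open>l < N\<close> by (simp add: step_boxes_def)
      from disjoint_family_onD[OF this, of 0 "Suc j"] show ?thesis using \<open>z \<in> A l 0\<close> that by auto
    qed
    then show ?thesis by (auto simp: Y_def add_point_def intro!: prod.cong)
  qed
  have X_add: "X (add_point z (measure \<omega>)) = X (measure \<omega>) + (\<Sum>i<Suc p. D i z \<omega>)" for z \<omega>
    unfolding X_def D_def by (rule step_integral_add_point[OF A])
  have X_mom: "all_moments P (\<lambda>\<omega>. X (measure \<omega>))"
    unfolding X_def by (rule all_moments_step_integral[OF A])
  have Y_mom: "all_moments P (\<lambda>\<omega>. Y l (measure \<omega>))" if "l < N" for l
    unfolding Y_def
    by (intro P.all_moments_prod P.all_moments_diff all_moments_evaluation P.all_moments_const)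
      (use A that in \<open>auto simp: step_boxes_def\<close>)
  note [measurable] = all_moments_measurable[OF X_mom] all_moments_measurable[OF Y_mom]
  have D_meas[measurable]: "(\<lambda>(z, \<omega>). D i z \<omega>) \<in> borel_measurable (\<mu> \<Otimes>\<^sub>M P)" if "i < Suc p" for i
    unfolding D_def by (rule measurable_step_integral_slice[OF A that])
  \<comment> \<open>The Mecke formula for the coordinate \<open>0\<close> of the \<open>l\<close>-th box: the compensator \<open>\<mu>(A\<^sub>l\<^sub>,\<^sub>0)\<close> removes
    the value before the point is added and leaves the difference \<open>\<Sum>\<^sub>i D\<^sub>i\<close>.\<close>
  have part: "integrable (\<mu> \<Otimes>\<^sub>M P)
        (\<lambda>(z, \<omega>). indicator (A l 0) z * (Y l (measure \<omega>) * (\<Sum>i<Suc p. D i z \<omega>)))" (is "integrable _ ?f")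
      "(LINT (z, \<omega>)|(\<mu> \<Otimes>\<^sub>M P). indicator (A l 0) z * (Y l (measure \<omega>) * (\<Sum>i<Suc p. D i z \<omega>)))
        = (LINT \<omega>|P. (measure \<omega> (A l 0) - measure \<mu> (A l 0)) * Y l (measure \<omega>) * X (measure \<omega>))"
    if l: "l < N" for l
  proof -
    have A0[measurable]: "A l 0 \<in> sets \<mu>" and A0_fin: "emeasure \<mu> (A l 0) < \<infinity>"
      using A l by (auto simp: step_boxes_def)
    let ?G = "\<lambda>c. Y l c * X c"
    have G_dep: "depends_on \<B> ?G"
      unfolding depends_on_def
    proof (intro allI impI)
      fix c c' :: "'z set \<Rightarrow> real"
      assume c: "\<forall>B\<in>\<B>. c B = c' B"
      then have "X c = X c'"
        using depends_on_step_integral[of A N "Suc p" \<mu> a] unfolding depends_on_def X_def \<B>_def by blast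
      moreover have "Y l c = Y l c'"
        using c inB[OF l] by (auto simp: Y_def intro!: prod.cong)
      ultimately show "?G c = ?G c'" by simp
    qed
    have [measurable]: "(\<lambda>(z, \<omega>). Y l (add_point z (measure \<omega>))) \<in> borel_measurable (\<mu> \<Otimes>\<^sub>M P)"
    proof -
      have "(\<lambda>(z, \<omega>). measure \<omega> (A l (Suc j)) + indicator (A l (Suc j)) z - measure \<mu> (A l (Suc j)))
          \<in> borel_measurable (\<mu> \<Otimes>\<^sub>M P)" if "j < p" for j
      proof -
        have [measurable]: "A l (Suc j) \<in> sets \<mu>" using A l that by (simp add: step_boxes_def)
        show ?thesis by measurable
      qed
      then show ?thesis
        unfolding Y_def add_point_def case_prod_beta' by (intro borel_measurable_prod) auto
    qed
    have G_joint: "(\<lambda>(z, \<omega>). ?G (add_point z (measure \<omega>))) \<in> borel_measurable (\<mu> \<Otimes>\<^sub>M P)"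
      unfolding X_add by measurable
    have G_int: "integrable P (\<lambda>\<omega>. ?G (measure \<omega>))"
      "integrable P (\<lambda>\<omega>. measure \<omega> (A l 0) * ?G (measure \<omega>))"
      by (intro all_moments_integrable all_moments_mult X_mom Y_mom[OF l]
          all_moments_evaluation A0 A0_fin)+
    have ind: "integrable \<mu> (indicator (A l 0) :: 'z \<Rightarrow> real)"
      using A0 A0_fin by (intro integrable_real_indicator)
    note mecke = mecke_cylinder_integral[OF \<B> inB[OF l zero_less_Suc] G_dep G_joint G_int(2)]
    note flat = integral_pair_product[OF ind G_int(1)]
    have f_eq: "?f = (\<lambda>x. (case x of (z, \<omega>) \<Rightarrow> indicator (A l 0) z * ?G (add_point z (measure \<omega>)))
        - (case x of (z, \<omega>) \<Rightarrow> indicator (A l 0) z * ?G (measure \<omega>)))"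
      using Y_add[OF l] X_add by (auto simp: fun_eq_iff indicator_def algebra_simps)
    show "integrable (\<mu> \<Otimes>\<^sub>M P) ?f"
      unfolding f_eq by (intro Bochner_Integration.integrable_diff mecke(1) flat(1))
    have "(LINT x|(\<mu> \<Otimes>\<^sub>M P). ?f x)
        = (LINT (z, \<omega>)|(\<mu> \<Otimes>\<^sub>M P). indicator (A l 0) z * ?G (add_point z (measure \<omega>)))
          - (LINT (z, \<omega>)|(\<mu> \<Otimes>\<^sub>M P). indicator (A l 0) z * ?G (measure \<omega>))"
      by (subst f_eq) (rule Bochner_Integration.integral_diff[OF mecke(1) flat(1)])
    also have "\<dots> = (LINT \<omega>|P. measure \<omega> (A l 0) * ?G (measure \<omega>))
        - measure \<mu> (A l 0) * (LINT \<omega>|P. ?G (measure \<omega>))"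
    proof (rule arg_cong2[where f="(-)", OF mecke(2)])
      have "(LINT z|\<mu>. indicator (A l 0) z) = measure \<mu> (A l 0)" using A0 A0_fin by simp
      with flat(2) show "(LINT (z, \<omega>)|(\<mu> \<Otimes>\<^sub>M P). indicator (A l 0) z * ?G (measure \<omega>))
          = measure \<mu> (A l 0) * (LINT \<omega>|P. ?G (measure \<omega>))"
        by (rule trans[OF _ arg_cong2[where f="(*)"]]) (rule refl)
    qed
    also have "\<dots> = (LINT \<omega>|P. measure \<omega> (A l 0) * ?G (measure \<omega>) - measure \<mu> (A l 0) * ?G (measure \<omega>))"
      using G_int by simp
    also have "\<dots> = (LINT \<omega>|P. (measure \<omega> (A l 0) - measure \<mu> (A l 0)) * Y l (measure \<omega>) * X (measure \<omega>))"
      by (simp add: algebra_simps)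
    finally show "(LINT x|(\<mu> \<Otimes>\<^sub>M P). ?f x)
        = (LINT \<omega>|P. (measure \<omega> (A l 0) - measure \<mu> (A l 0)) * Y l (measure \<omega>) * X (measure \<omega>))" .
  qed
  let ?h = "\<lambda>(z, \<omega>). D 0 z \<omega> * (\<Sum>i<Suc p. D i z \<omega>)"
  have h_eq: "?h = (\<lambda>x. \<Sum>l<N. a l * (case x of (z, \<omega>) \<Rightarrow>
      indicator (A l 0) z * (Y l (measure \<omega>) * (\<Sum>i<Suc p. D i z \<omega>))))"
    unfolding D0_eq by (auto simp: fun_eq_iff sum_distrib_right mult.assoc simp del: sum.lessThan_Suc)
  have h_int: "integrable (\<mu> \<Otimes>\<^sub>M P) ?h"
    unfolding h_eq by (intro Bochner_Integration.integrable_sum integrable_mult_right part(1)) auto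
  have "(LINT \<omega>|P. (X (measure \<omega>))\<^sup>2)
      = (LINT \<omega>|P. (\<Sum>l<N. a l * ((measure \<omega> (A l 0) - measure \<mu> (A l 0)) * Y l (measure \<omega>) * X (measure \<omega>))))"
    by (intro Bochner_Integration.integral_cong refl)
      (subst power2_eq_square, subst X_eq, simp add: sum_distrib_right mult.assoc)
  also have "\<dots> = (\<Sum>l<N. a l * (LINT \<omega>|P. (measure \<omega> (A l 0) - measure \<mu> (A l 0)) * Y l (measure \<omega>) * X (measure \<omega>)))"
  proof (subst Bochner_Integration.integral_sum)
    fix l assume "l \<in> {..<N}"
    then have "all_moments P (\<lambda>\<omega>. a l * ((measure \<omega> (A l 0) - measure \<mu> (A l 0)) * Y l (measure \<omega>) * X (measure \<omega>)))"
      using A by (intro all_moments_mult P.all_moments_diff P.all_moments_const X_mom Y_mom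
          all_moments_evaluation) (auto simp: step_boxes_def)
    then show "integrable P (\<lambda>\<omega>. a l * ((measure \<omega> (A l 0) - measure \<mu> (A l 0)) * Y l (measure \<omega>) * X (measure \<omega>)))"
      by (rule all_moments_integrable)
  qed simp
  also have "\<dots> = (LINT x|(\<mu> \<Otimes>\<^sub>M P). ?h x)"
    unfolding h_eq
    by (subst Bochner_Integration.integral_sum)
      (auto simp: part simp del: sum.lessThan_Suc intro!: integrable_mult_right part(1))
  finally have EX: "(LINT \<omega>|P. (X (measure \<omega>))\<^sup>2) = (LINT x|(\<mu> \<Otimes>\<^sub>M P). ?h x)" .
  define K where "K = (\<integral>\<^sup>+x. ennreal ((step_kernel (Suc p) N a A x)\<^sup>2) \<partial>power_measure \<mu> (Suc p))"
  \<comment> \<open>The induction hypothesis at fixed \<open>z\<close>, then Fubini for the coordinate \<open>i\<close>.\<close>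
  have slice: "(\<integral>\<^sup>+x. ennreal ((case x of (z, \<omega>) \<Rightarrow> D i z \<omega>)\<^sup>2) \<partial>(\<mu> \<Otimes>\<^sub>M P)) \<le> ennreal (fact p) * K"
    if i: "i < Suc p" for i
  proof -
    have ip: "i \<le> p" using i by simp
    note [measurable] = D_meas[OF i] step_kernel_measurable[OF A] measurable_insert_coord[OF ip]
    have "(\<integral>\<^sup>+x. ennreal ((case x of (z, \<omega>) \<Rightarrow> D i z \<omega>)\<^sup>2) \<partial>(\<mu> \<Otimes>\<^sub>M P))
        = (\<integral>\<^sup>+z. \<integral>\<^sup>+\<omega>. ennreal ((D i z \<omega>)\<^sup>2) \<partial>P \<partial>\<mu>)"
      by (subst P.nn_integral_fst[symmetric]) auto
    also have "\<dots> \<le> (\<integral>\<^sup>+z. ennreal (fact p) * (\<integral>\<^sup>+x. ennreal ((step_kernel p N (slice_coeff i z a A)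
        (slice_boxes i A) x)\<^sup>2) \<partial>power_measure \<mu> p) \<partial>\<mu>)"
      unfolding D_def by (intro nn_integral_mono Suc.IH step_boxes_slice[OF A ip])
    also have "\<dots> = (\<integral>\<^sup>+z. ennreal (fact p) * (\<integral>\<^sup>+x. ennreal ((step_kernel (Suc p) N a A
        (insert_coord i z x))\<^sup>2) \<partial>power_measure \<mu> p) \<partial>\<mu>)"
      using ip by (intro nn_integral_cong arg_cong2[where f="(*)"] refl)
        (auto simp: step_kernel_insert_coord space_PiM PiE_def)
    also have "\<dots> = ennreal (fact p) * (\<integral>\<^sup>+z. \<integral>\<^sup>+x. ennreal ((step_kernel (Suc p) N a A
        (insert_coord i z x))\<^sup>2) \<partial>power_measure \<mu> p \<partial>\<mu>)"
    proof (rule nn_integral_cmult)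
      interpret product_sigma_finite "\<lambda>_::nat. \<mu>" ..
      interpret pow: sigma_finite_measure "power_measure \<mu> p" by (rule sigma_finite) simp
      show "(\<lambda>z. \<integral>\<^sup>+x. ennreal ((step_kernel (Suc p) N a A (insert_coord i z x))\<^sup>2) \<partial>power_measure \<mu> p)
          \<in> borel_measurable \<mu>"
        by measurable
    qed
    also have "\<dots> = ennreal (fact p) * K"
      unfolding K_def by (subst control.nn_integral_insert_coord[OF ip]) auto
    finally show ?thesis .
  qed
  have "(\<integral>\<^sup>+\<omega>. ennreal ((X (measure \<omega>))\<^sup>2) \<partial>P) = ennreal (LINT \<omega>|P. (X (measure \<omega>))\<^sup>2)"
    by (intro nn_integral_eq_integral all_moments_square X_mom) auto
  also have "\<dots> \<le> ennreal (norm (LINT x|(\<mu> \<Otimes>\<^sub>M P). ?h x))"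
    unfolding EX by (intro ennreal_leI) simp
  also have "\<dots> \<le> (\<integral>\<^sup>+x. ennreal (norm (?h x)) \<partial>(\<mu> \<Otimes>\<^sub>M P))"
    by (rule integral_norm_bound_ennreal[OF h_int])
  also have "\<dots> \<le> (\<integral>\<^sup>+x. (\<Sum>i<Suc p. ennreal (1/2) * (ennreal ((case x of (z, \<omega>) \<Rightarrow> D 0 z \<omega>)\<^sup>2)
      + ennreal ((case x of (z, \<omega>) \<Rightarrow> D i z \<omega>)\<^sup>2))) \<partial>(\<mu> \<Otimes>\<^sub>M P))"
  proof (rule nn_integral_mono)
    fix x :: "'z \<times> 'z measure"
    obtain z \<omega> where x: "x = (z, \<omega>)" by (cases x)
    have "\<bar>D 0 z \<omega> * (\<Sum>i<Suc p. D i z \<omega>)\<bar> \<le> (\<Sum>i<Suc p. \<bar>D 0 z \<omega> * D i z \<omega>\<bar>)"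
      unfolding sum_distrib_left by (rule sum_abs)
    also have "\<dots> \<le> (\<Sum>i<Suc p. 1/2 * ((D 0 z \<omega>)\<^sup>2 + (D i z \<omega>)\<^sup>2))"
    proof (rule sum_mono)
      fix i
      show "\<bar>D 0 z \<omega> * D i z \<omega>\<bar> \<le> 1/2 * ((D 0 z \<omega>)\<^sup>2 + (D i z \<omega>)\<^sup>2)"
        using sum_squares_bound[of "\<bar>D 0 z \<omega>\<bar>" "\<bar>D i z \<omega>\<bar>"] by (simp add: abs_mult)
    qed
    finally have "ennreal \<bar>D 0 z \<omega> * (\<Sum>i<Suc p. D i z \<omega>)\<bar>
        \<le> ennreal (\<Sum>i<Suc p. 1/2 * ((D 0 z \<omega>)\<^sup>2 + (D i z \<omega>)\<^sup>2))"
      by (rule ennreal_leI)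
    also have "\<dots> = (\<Sum>i<Suc p. ennreal (1/2) * (ennreal ((D 0 z \<omega>)\<^sup>2) + ennreal ((D i z \<omega>)\<^sup>2)))"
      by (subst sum_ennreal[symmetric], simp, intro sum.cong refl,
          subst ennreal_mult, auto simp: ennreal_plus)
    finally show "ennreal (norm (?h x)) \<le> (\<Sum>i<Suc p. ennreal (1/2) *
        (ennreal ((case x of (z, \<omega>) \<Rightarrow> D 0 z \<omega>)\<^sup>2) + ennreal ((case x of (z, \<omega>) \<Rightarrow> D i z \<omega>)\<^sup>2)))"
      by (simp add: x del: sum.lessThan_Suc)
  qed
  also have "\<dots> = (\<Sum>i<Suc p. ennreal (1/2) *
      ((\<integral>\<^sup>+x. ennreal ((case x of (z, \<omega>) \<Rightarrow> D 0 z \<omega>)\<^sup>2) \<partial>(\<mu> \<Otimes>\<^sub>M P))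
        + (\<integral>\<^sup>+x. ennreal ((case x of (z, \<omega>) \<Rightarrow> D i z \<omega>)\<^sup>2) \<partial>(\<mu> \<Otimes>\<^sub>M P))))"
    using D_meas by (subst nn_integral_sum) (auto simp: nn_integral_cmult nn_integral_add intro!: sum.cong)
  also have "\<dots> \<le> (\<Sum>i<Suc p. ennreal (1/2) * (ennreal (fact p) * K + ennreal (fact p) * K))"
    by (intro sum_mono mult_left_mono add_mono slice) auto
  also have "\<dots> = (\<Sum>i<Suc p. ennreal (fact p) * K)"
  proof (intro sum.cong refl)
    have "ennreal (1/2) * ennreal 2 = 1" by (subst ennreal_mult[symmetric]) auto
    then have "(ennreal (1/2) * ennreal 2) * x = x" for x by simp
    then show "ennreal (1/2) * (ennreal (fact p) * K + ennreal (fact p) * K) = ennreal (fact p) * K"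
      by (metis mult.assoc mult_2 ennreal_numeral)
  qed
  also have "\<dots> = ennreal (fact (Suc p)) * K"
  proof -
    have "ennreal (fact (Suc p)) = of_nat (Suc p) * ennreal (fact p)"
      unfolding fact_Suc ennreal_of_nat_eq_real_of_nat by (rule ennreal_mult) auto
    then show ?thesis by (simp add: mult.assoc)
  qed
  finally show ?case unfolding X_def K_def .
qed

section \<open>From step functions to multiple integrals\<close>

lemma nn_integral_square_triangle:
  fixes f g h :: "'a \<Rightarrow> real"
  assumes [measurable]: "f \<in> borel_measurable M" "g \<in> borel_measurable M" "h \<in> borel_measurable M"
  shows "(\<integral>\<^sup>+x. ennreal ((f x - h x)\<^sup>2) \<partial>M)
    \<le> 2 * (\<integral>\<^sup>+x. ennreal ((f x - g x)\<^sup>2) \<partial>M) + 2 * (\<integral>\<^sup>+x. ennreal ((g x - h x)\<^sup>2) \<partial>M)"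
proof -
  have "(\<integral>\<^sup>+x. ennreal ((f x - h x)\<^sup>2) \<partial>M)
      \<le> (\<integral>\<^sup>+x. 2 * ennreal ((f x - g x)\<^sup>2) + 2 * ennreal ((g x - h x)\<^sup>2) \<partial>M)"
  proof (rule nn_integral_mono)
    fix x
    have "(f x - h x)\<^sup>2 \<le> 2 * (f x - g x)\<^sup>2 + 2 * (g x - h x)\<^sup>2"
      using sum_squares_bound[of "f x - g x" "g x - h x"] by (simp add: power2_eq_square algebra_simps)
    then show "ennreal ((f x - h x)\<^sup>2) \<le> 2 * ennreal ((f x - g x)\<^sup>2) + 2 * ennreal ((g x - h x)\<^sup>2)"
      by (simp add: ennreal_leI flip: ennreal_mult ennreal_plus ennreal_numeral)
  qed
  then show ?thesis by (simp add: nn_integral_add nn_integral_cmult)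
qed

lemma nn_integral_square_sum:
  fixes f :: "'i \<Rightarrow> 'a \<Rightarrow> real"
  assumes "\<And>i. i \<in> I \<Longrightarrow> f i \<in> borel_measurable M"
  shows "(\<integral>\<^sup>+x. ennreal ((\<Sum>i\<in>I. f i x)\<^sup>2) \<partial>M)
    \<le> of_nat (card I) * (\<Sum>i\<in>I. \<integral>\<^sup>+x. ennreal ((f i x)\<^sup>2) \<partial>M)"
proof -
  have "(\<integral>\<^sup>+x. ennreal ((\<Sum>i\<in>I. f i x)\<^sup>2) \<partial>M)
      \<le> (\<integral>\<^sup>+x. of_nat (card I) * (\<Sum>i\<in>I. ennreal ((f i x)\<^sup>2)) \<partial>M)"
  proof (rule nn_integral_mono)
    fix x
    have "ennreal ((\<Sum>i\<in>I. f i x)\<^sup>2) \<le> ennreal (real (card I) * (\<Sum>i\<in>I. (f i x)\<^sup>2))"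
      using sum_squared_le_sum_of_squares[of "\<lambda>i. f i x" I] by (intro ennreal_leI) (simp add: mult.commute)
    also have "\<dots> = of_nat (card I) * (\<Sum>i\<in>I. ennreal ((f i x)\<^sup>2))"
      by (simp add: ennreal_mult sum_nonneg ennreal_of_nat_eq_real_of_nat)
    finally show "ennreal ((\<Sum>i\<in>I. f i x)\<^sup>2) \<le> of_nat (card I) * (\<Sum>i\<in>I. ennreal ((f i x)\<^sup>2))" .
  qed
  also have "\<dots> = of_nat (card I) * (\<Sum>i\<in>I. \<integral>\<^sup>+x. ennreal ((f i x)\<^sup>2) \<partial>M)"
    using assms by (subst nn_integral_cmult) (auto simp: nn_integral_sum simp del: sum_ennreal)
  finally show ?thesis .
qed

lemma converges_L2_nn_integral:
  assumes "converges_L2 M f g"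
  shows "(\<lambda>n. \<integral>\<^sup>+x. ennreal ((f n x - g x)\<^sup>2) \<partial>M) \<longlonglongrightarrow> 0"
proof -
  have "integrable M (\<lambda>x. (f n x - g x)\<^sup>2)" for n
  proof (rule Bochner_Integration.integrable_bound)
    have "square_integrable M (f n)" "square_integrable M g"
      using assms by (auto simp: converges_L2_def)
    then show "integrable M (\<lambda>x. 2 * (f n x)\<^sup>2 + 2 * (g x)\<^sup>2)"
      and "(\<lambda>x. (f n x - g x)\<^sup>2) \<in> borel_measurable M"
      by (auto simp: square_integrable_def)
    have "(f n x - g x)\<^sup>2 \<le> 2 * (f n x)\<^sup>2 + 2 * (g x)\<^sup>2" for x
      using sum_squares_bound[of "f n x" "- g x"] by (simp add: power2_eq_square algebra_simps)
    then show "AE x in M. norm ((f n x - g x)\<^sup>2) \<le> norm (2 * (f n x)\<^sup>2 + 2 * (g x)\<^sup>2)" by auto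
  qed
  then have "(\<integral>\<^sup>+x. ennreal ((f n x - g x)\<^sup>2) \<partial>M) = ennreal (LINT x|M. (f n x - g x)\<^sup>2)" for n
    by (intro nn_integral_eq_integral) auto
  moreover have "(\<lambda>n. ennreal (LINT x|M. (f n x - g x)\<^sup>2)) \<longlonglongrightarrow> ennreal 0"
    using assms by (intro tendsto_ennrealI) (simp add: converges_L2_def)
  ultimately show ?thesis by simp
qed

lemma sum_append:
  fixes f g :: "nat \<Rightarrow> 'a::comm_monoid_add"
  shows "(\<Sum>l<N + M. if l < N then f l else g (l - N)) = (\<Sum>l<N. f l) + (\<Sum>l<M. g l)"
proof (induction M)
  case 0
  show ?case by (auto intro!: sum.cong)
qed (simp add: add.assoc)

lemma step_difference:
  assumes "step_boxes \<mu> q N A" "step_boxes \<mu> q N' A'"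
  obtains N'' a'' A'' where "step_boxes \<mu> q N'' A''"
    and "\<And>x. step_kernel q N'' a'' A'' x = step_kernel q N a A x - step_kernel q N' a' A' x"
    and "\<And>c. step_integral \<mu> q N'' a'' A'' c = step_integral \<mu> q N a A c - step_integral \<mu> q N' a' A' c"
proof
  let ?A = "\<lambda>l. if l < N then A l else A' (l - N)" and ?a = "\<lambda>l. if l < N then a l else - a' (l - N)"
  show "step_boxes \<mu> q (N + N') ?A" using assms by (auto simp: step_boxes_def)
  show "step_kernel q (N + N') ?a ?A x = step_kernel q N a A x - step_kernel q N' a' A' x" for x
  proof -
    have "step_kernel q (N + N') ?a ?A x = (\<Sum>l<N + N'. if l < N then a l * indicator (PiE {..<q} (A l)) x
        else - a' (l - N) * indicator (PiE {..<q} (A' (l - N))) x)"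
      unfolding step_kernel_def by (intro sum.cong) auto
    also have "\<dots> = (\<Sum>l<N. a l * indicator (PiE {..<q} (A l)) x)
        + (\<Sum>l<N'. - a' l * indicator (PiE {..<q} (A' l)) x)"
      by (rule sum_append)
    finally show ?thesis by (simp only: step_kernel_def mult_minus_left sum_negf add_uminus_conv_diff)
  qed
  show "step_integral \<mu> q (N + N') ?a ?A c = step_integral \<mu> q N a A c - step_integral \<mu> q N' a' A' c" for c
  proof -
    have "step_integral \<mu> q (N + N') ?a ?A c = (\<Sum>l<N + N'. if l < N
        then a l * (\<Prod>i<q. c (A l i) - measure \<mu> (A l i))
        else - a' (l - N) * (\<Prod>i<q. c (A' (l - N) i) - measure \<mu> (A' (l - N) i)))"
      unfolding step_integral_def by (intro sum.cong) auto
    also have "\<dots> = (\<Sum>l<N. a l * (\<Prod>i<q. c (A l i) - measure \<mu> (A l i)))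
        + (\<Sum>l<N'. - a' l * (\<Prod>i<q. c (A' l i) - measure \<mu> (A' l i)))"
      by (rule sum_append)
    finally show ?thesis by (simp only: step_integral_def mult_minus_left sum_negf add_uminus_conv_diff)
  qed
qed

text \<open>
  The Ito inequality for the difference with an approximating step function, in the limit. The factor
  \<open>4\<close> comes from using \<open>(x + y)\<^sup>2 \<le> 2x\<^sup>2 + 2y\<^sup>2\<close> twice in place of the triangle inequality.
\<close>

lemma (in poisson_space) multiple_integral_distance:
  assumes A: "step_boxes \<mu> q N A" and Y: "multiple_integral \<mu> P q f Y"
  shows "(\<integral>\<^sup>+\<omega>. ennreal ((step_integral \<mu> q N a A (measure \<omega>) - Y \<omega>)\<^sup>2) \<partial>P)
    \<le> ennreal (4 * fact q) * (\<integral>\<^sup>+x. ennreal ((step_kernel q N a A x - f x)\<^sup>2) \<partial>power_measure \<mu> q)"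
    (is "?L \<le> ennreal (4 * fact q) * ?R")
proof -
  obtain fs Xs where el: "\<And>n. elementary_integral \<mu> q (fs n) (Xs n)"
    and fs: "converges_L2 (power_measure \<mu> q) fs f" and Xs: "converges_L2 P Xs Y"
    using Y by (auto simp: multiple_integral_def)
  let ?d = "\<lambda>n. \<integral>\<^sup>+x. ennreal ((fs n x - f x)\<^sup>2) \<partial>power_measure \<mu> q"
  let ?e = "\<lambda>n. \<integral>\<^sup>+\<omega>. ennreal ((Xs n \<omega> - Y \<omega>)\<^sup>2) \<partial>P"
  have meas: "fs n \<in> borel_measurable (power_measure \<mu> q)" "f \<in> borel_measurable (power_measure \<mu> q)"
    "Xs n \<in> borel_measurable P" "Y \<in> borel_measurable P" for n
    using fs Xs by (auto simp: converges_L2_def square_integrable_def)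
  have bound: "?L \<le> 2 * (ennreal (fact q) * (2 * ?R + 2 * ?d n)) + 2 * ?e n" for n
  proof -
    obtain N' a' A' where A': "step_boxes \<mu> q N' A'" and fs_n: "fs n = step_kernel q N' a' A'"
      and Xs_n: "Xs n = (\<lambda>\<omega>. step_integral \<mu> q N' a' A' (measure \<omega>))"
      using el[of n] unfolding elementary_integral_iff by blast
    obtain N'' A'' a'' where A'': "step_boxes \<mu> q N'' A''"
      and k: "\<And>x. step_kernel q N'' a'' A'' x = step_kernel q N a A x - step_kernel q N' a' A' x"
      and i: "\<And>c. step_integral \<mu> q N'' a'' A'' c = step_integral \<mu> q N a A c - step_integral \<mu> q N' a' A' c"
      by (rule step_difference[OF A A', of a a']) (rule that)
    have "?L \<le> 2 * (\<integral>\<^sup>+\<omega>. ennreal ((step_integral \<mu> q N a A (measure \<omega>) - Xs n \<omega>)\<^sup>2) \<partial>P) + 2 * ?e n"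
      by (intro nn_integral_square_triangle meas all_moments_measurable all_moments_step_integral A)
    also have "(\<integral>\<^sup>+\<omega>. ennreal ((step_integral \<mu> q N a A (measure \<omega>) - Xs n \<omega>)\<^sup>2) \<partial>P)
        \<le> ennreal (fact q) * (\<integral>\<^sup>+x. ennreal ((step_kernel q N a A x - fs n x)\<^sup>2) \<partial>power_measure \<mu> q)"
      using ito_inequality[OF A'', of a''] unfolding k i fs_n Xs_n .
    also have "(\<integral>\<^sup>+x. ennreal ((step_kernel q N a A x - fs n x)\<^sup>2) \<partial>power_measure \<mu> q)
        \<le> 2 * (\<integral>\<^sup>+x. ennreal ((step_kernel q N a A x - f x)\<^sup>2) \<partial>power_measure \<mu> q)
          + 2 * (\<integral>\<^sup>+x. ennreal ((f x - fs n x)\<^sup>2) \<partial>power_measure \<mu> q)"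
      by (intro nn_integral_square_triangle meas step_kernel_measurable A)
    also have "(\<lambda>x. (f x - fs n x)\<^sup>2) = (\<lambda>x. (fs n x - f x)\<^sup>2)"
      by (simp add: power2_commute)
    finally show ?thesis by (simp add: mult_left_mono add_mono)
  qed
  have "(\<lambda>n. 2 * (ennreal (fact q) * (2 * ?R + 2 * ?d n)) + 2 * ?e n)
      \<longlonglongrightarrow> 2 * (ennreal (fact q) * (2 * ?R + 2 * 0)) + 2 * 0"
    by (intro tendsto_add ennreal_tendsto_cmult tendsto_const converges_L2_nn_integral fs Xs) auto
  then have "?L \<le> 2 * (ennreal (fact q) * (2 * ?R + 2 * 0)) + 2 * 0"
    using bound by (intro LIMSEQ_le_const) auto
  also have "\<dots> = (2 * ennreal (fact q) * 2) * ?R" by (simp add: mult.assoc)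
  also have "2 * ennreal (fact q) * 2 = ennreal (4 * fact q)"
    by (simp flip: ennreal_mult ennreal_numeral)
  finally show ?thesis .
qed

lemma multiple_integral_approximation:
  assumes "multiple_integral \<mu> P q f X" and e: "0 < (e::real)"
  shows "\<exists>N a A. step_boxes \<mu> q N A
    \<and> (\<integral>\<^sup>+\<omega>. ennreal ((step_integral \<mu> q N a A (measure \<omega>) - X \<omega>)\<^sup>2) \<partial>P) \<le> ennreal e
    \<and> (\<integral>\<^sup>+x. ennreal ((step_kernel q N a A x - f x)\<^sup>2) \<partial>power_measure \<mu> q) \<le> ennreal e"
proof -
  obtain fs Xs where el: "\<And>n. elementary_integral \<mu> q (fs n) (Xs n)"
    and fs: "converges_L2 (power_measure \<mu> q) fs f" and Xs: "converges_L2 P Xs X"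
    using assms by (auto simp: multiple_integral_def)
  have "\<forall>\<^sub>F n in sequentially. (\<integral>\<^sup>+x. ennreal ((fs n x - f x)\<^sup>2) \<partial>power_measure \<mu> q) < ennreal e"
    using e by (intro order_tendstoD(2)[OF converges_L2_nn_integral[OF fs]]) auto
  moreover have "\<forall>\<^sub>F n in sequentially. (\<integral>\<^sup>+x. ennreal ((Xs n x - X x)\<^sup>2) \<partial>P) < ennreal e"
    using e by (intro order_tendstoD(2)[OF converges_L2_nn_integral[OF Xs]]) auto
  ultimately have "\<forall>\<^sub>F n in sequentially.
      (\<integral>\<^sup>+x. ennreal ((fs n x - f x)\<^sup>2) \<partial>power_measure \<mu> q) < ennreal e
      \<and> (\<integral>\<^sup>+x. ennreal ((Xs n x - X x)\<^sup>2) \<partial>P) < ennreal e"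
    by (rule eventually_conj)
  then obtain n where "(\<integral>\<^sup>+x. ennreal ((fs n x - f x)\<^sup>2) \<partial>power_measure \<mu> q) < ennreal e"
      "(\<integral>\<^sup>+x. ennreal ((Xs n x - X x)\<^sup>2) \<partial>P) < ennreal e"
    by (auto simp: eventually_sequentially)
  moreover obtain N a A where "step_boxes \<mu> q N A" "fs n = step_kernel q N a A"
      "Xs n = (\<lambda>\<omega>. step_integral \<mu> q N a A (measure \<omega>))"
    using el[of n] unfolding elementary_integral_iff by blast
  ultimately show ?thesis by (intro exI[of _ N] exI[of _ a] exI[of _ A]) (auto simp: less_imp_le)
qed

text \<open>
  Inserting at position \<open>i\<close> and at position \<open>0\<close> differ by a cyclic permutation of the coordinates.
\<close>

lemma (in sigma_finite_measure) symmetric_insert_coord: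
  assumes f: "symmetric_L2 M (Suc p) f" and i: "i \<le> p"
  shows "AE z in M. AE x in power_measure M p. f (insert_coord i z x) = f (insert_coord 0 z x)"
proof -
  interpret product_sigma_finite "\<lambda>_::nat. M" ..
  interpret pow: sigma_finite_measure "power_measure M p" by (rule sigma_finite) simp
  interpret pr: pair_sigma_finite M "power_measure M p" ..
  define \<pi> where "\<pi> j = (if j < i then Suc j else if j = i then 0 else j)" for j
  have "bij_betw \<pi> {..<Suc p} {..<Suc p}"
    by (rule bij_betwI[where g="\<lambda>j. if j = 0 then i else if j \<le> i then j - 1 else j"])
      (use i in \<open>auto simp: \<pi>_def\<close>)
  then have "\<pi> permutes {..<Suc p}"
    using i by (intro bij_imp_permutes) (auto simp: \<pi>_def)
  then have "AE x in power_measure M (Suc p). f (x \<circ> \<pi>) = f x"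
    using f by (simp add: symmetric_L2_def)
  then have "AE x in distr (M \<Otimes>\<^sub>M power_measure M p) (power_measure M (Suc p))
      (\<lambda>(z, x). insert_coord 0 z x). f (x \<circ> \<pi>) = f x"
    by (subst distr_insert_coord) auto
  then have "AE w in M \<Otimes>\<^sub>M power_measure M p. f ((case w of (z, x) \<Rightarrow> insert_coord 0 z x) \<circ> \<pi>)
      = f (case w of (z, x) \<Rightarrow> insert_coord 0 z x)"
    by (rule AE_distrD[rotated]) (rule measurable_insert_coord, simp)
  from pr.AE_pair[OF this]
  have "AE z in M. AE x in power_measure M p. f (insert_coord 0 z x \<circ> \<pi>) = f (insert_coord 0 z x)"
    by simp
  moreover have "insert_coord 0 z x \<circ> \<pi> = insert_coord i z x" for z :: 'a and x
    by (auto simp: fun_eq_iff insert_coord_def \<pi>_def)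
  ultimately show ?thesis by simp
qed

lemma AE_tendsto_zero_of_summable:
  fixes h :: "nat \<Rightarrow> 'a \<Rightarrow> ennreal"
  assumes [measurable]: "\<And>n. h n \<in> borel_measurable M"
    and le: "\<And>n. (\<integral>\<^sup>+x. h n x \<partial>M) \<le> ennreal ((1/2) ^ n)"
  shows "AE x in M. (\<lambda>n. h n x) \<longlonglongrightarrow> 0"
proof -
  have "(\<integral>\<^sup>+x. (\<Sum>n. h n x) \<partial>M) = (\<Sum>n. \<integral>\<^sup>+x. h n x \<partial>M)" by (rule nn_integral_suminf) simp
  also have "\<dots> \<le> (\<Sum>n. ennreal ((1/2) ^ n))" by (intro suminf_le le) auto
  also have "\<dots> < \<infinity>"
    by (subst suminf_ennreal2) (auto intro: summable_geometric)
  finally have "AE x in M. (\<Sum>n. h n x) \<noteq> \<infinity>"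
    by (intro nn_integral_PInf_AE) auto
  then show ?thesis
  proof eventually_elim
    case (elim x)
    have fin: "h n x \<noteq> \<infinity>" for n
    proof -
      have "h n x = sum (\<lambda>n. h n x) {n}" by simp
      also have "\<dots> \<le> (\<Sum>n. h n x)" by (rule sum_le_suminf) auto
      finally show ?thesis using elim by (auto simp: top_unique)
    qed
    then have eq: "h n x = ennreal (enn2real (h n x))" for n by (simp add: less_top)
    then have "(\<Sum>n. ennreal (enn2real (h n x))) \<noteq> \<top>" using elim by simp
    then have "summable (\<lambda>n. enn2real (h n x))" by (intro summable_suminf_not_top) auto
    then have "(\<lambda>n. ennreal (enn2real (h n x))) \<longlonglongrightarrow> ennreal 0"
      by (intro tendsto_ennrealI summable_LIMSEQ_zero)
    then show ?case using eq by simp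
  qed
qed

section \<open>Simultaneous approximation of a functional and its derivative\<close>

text \<open>
  This connects the chaotic definition of the derivative with the addition of a point. Truncate the
  chaotic expansion of \<open>F\<close> after \<open>N\<close> terms and replace each kernel \<open>f\<^sub>k\<^sub>+\<^sub>1\<close> by a step function \<open>g\<close> so
  close to it that all errors together are at most \<open>2\<^sup>-\<^sup>N\<close>. The difference operator of the resulting
  functional \<open>W\<^sub>N\<close> is a sum of integrals of slices of the step functions. For almost every \<open>z\<close> each slice of
  \<open>f\<^sub>k\<^sub>+\<^sub>1\<close> equals \<open>f\<^sub>k\<^sub>+\<^sub>1(z, \<cdot>)\<close> by symmetry, so the squared distance of the \<open>k + 1\<close> integrals to
  \<open>I\<^sub>k(f\<^sub>k\<^sub>+\<^sub>1(z, \<cdot>))\<close> is controlled by the norms of the slices of \<open>g - f\<^sub>k\<^sub>+\<^sub>1\<close>. The integrals over \<open>z\<close> of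
  these squared norms are summable in \<open>N\<close>, hence the norms vanish in the limit for almost every \<open>z\<close>. The versions
  \<open>Y\<^sub>k\<close> of \<open>I\<^sub>k(f\<^sub>k\<^sub>+\<^sub>1(z, \<cdot>))\<close> depend on \<open>z\<close> without any measurability; only the bounds, which are
  measurable in \<open>z\<close>, are integrated.
\<close>

lemma (in poisson_space) derivative_approximation:
  assumes "malliavin_derivative \<mu> P F U"
  shows "\<exists>W.
    (\<forall>n. \<exists>\<B>. finite \<B> \<and> (\<forall>A\<in>\<B>. A \<in> sets \<mu> \<and> emeasure \<mu> A < \<infinity>) \<and> depends_on \<B> (W n)) \<and>
    (\<forall>n. (\<lambda>\<omega>. W n (measure \<omega>)) \<in> borel_measurable P) \<and>
    (\<forall>n. (\<lambda>(z, \<omega>). W n (add_point z (measure \<omega>))) \<in> borel_measurable (\<mu> \<Otimes>\<^sub>M P)) \<and>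
    (\<lambda>n. \<integral>\<^sup>+\<omega>. ennreal ((W n (measure \<omega>) - F \<omega>)\<^sup>2) \<partial>P) \<longlonglongrightarrow> 0 \<and>
    (AE z in \<mu>. (\<lambda>n. \<integral>\<^sup>+\<omega>. ennreal ((W n (add_point z (measure \<omega>)) - W n (measure \<omega>) - U z \<omega>)\<^sup>2) \<partial>P)
      \<longlonglongrightarrow> 0)"
proof -
  obtain f X where chaos: "chaotic_decomposition \<mu> P F f X"
    and der: "AE z in \<mu>. \<exists>Y.
        (\<forall>k. multiple_integral \<mu> P k (\<lambda>x. f (Suc k) (case_nat z x)) (Y k)) \<and>
        converges_L2 P (\<lambda>N \<omega>. \<Sum>k<N. real (Suc k) * Y k \<omega>) (U z)"
    using assms by (auto simp: malliavin_derivative_def)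
  have sym: "symmetric_L2 \<mu> (Suc k) (f (Suc k))"
    and mi: "multiple_integral \<mu> P (Suc k) (f (Suc k)) (X (Suc k))" for k
    using chaos by (auto simp: chaotic_decomposition_def)
  define E where "E = (LINT \<omega>|P. F \<omega>)"
  have conv: "converges_L2 P (\<lambda>N \<omega>. E + (\<Sum>k<N. X (Suc k) \<omega>)) F"
    using chaos by (simp add: chaotic_decomposition_def E_def sum.atLeast1_atMost_eq)
  define S where "S N = Sigma {..<N} (\<lambda>k. {..<Suc k})" for N :: nat
  have S_fin: "finite (S N)" for N by (simp add: S_def)
  \<comment> \<open>Both error estimates below add up at most \<open>R N\<close> times the error \<open>e N\<close> of a single kernel; the
    leading \<open>1\<close> keeps the quotient defined for \<open>N = 0\<close>.\<close>
  define R where "R N = 1 + real N * real N + real (card (S N)) * (\<Sum>(k, i)\<in>S N. 4 * fact k)" for N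
  define e where "e N = (1/2) ^ N / R N" for N
  have R1: "1 \<le> R N" for N by (auto simp: R_def intro!: add_increasing2 sum_nonneg mult_nonneg_nonneg)
  have e_pos: "0 < e N" for N using R1[of N] by (simp add: e_def)
  define approx where "approx N k d \<longleftrightarrow> (case d of (M, a, A) \<Rightarrow> step_boxes \<mu> (Suc k) M A
      \<and> (\<integral>\<^sup>+\<omega>. ennreal ((step_integral \<mu> (Suc k) M a A (measure \<omega>) - X (Suc k) \<omega>)\<^sup>2) \<partial>P) \<le> ennreal (e N)
      \<and> (\<integral>\<^sup>+x. ennreal ((step_kernel (Suc k) M a A x - f (Suc k) x)\<^sup>2) \<partial>power_measure \<mu> (Suc k)) \<le> ennreal (e N))"
    for N k d
  define d where "d N k = (SOME d. approx N k d)" for N k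
  have d: "approx N k (d N k)" for N k
  proof -
    have "\<exists>d. approx N k d"
      using multiple_integral_approximation[OF mi e_pos, of k N] by (auto simp: approx_def)
    then show ?thesis unfolding d_def by (rule someI_ex)
  qed
  define M where "M N k = fst (d N k)" for N k
  define a where "a N k = fst (snd (d N k))" for N k
  define A where "A N k = snd (snd (d N k))" for N k
  have boxes: "step_boxes \<mu> (Suc k) (M N k) (A N k)"
    and err_int: "(\<integral>\<^sup>+\<omega>. ennreal ((step_integral \<mu> (Suc k) (M N k) (a N k) (A N k) (measure \<omega>)
      - X (Suc k) \<omega>)\<^sup>2) \<partial>P) \<le> ennreal (e N)"
    and err_ker: "(\<integral>\<^sup>+x. ennreal ((step_kernel (Suc k) (M N k) (a N k) (A N k) x - f (Suc k) x)\<^sup>2)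
      \<partial>power_measure \<mu> (Suc k)) \<le> ennreal (e N)" for N k
    using d[of N k] by (auto simp: approx_def M_def a_def A_def case_prod_beta')
  define I where "I N k = step_integral \<mu> (Suc k) (M N k) (a N k) (A N k)" for N k
  define D where "D N k i z \<omega> = step_integral \<mu> k (M N k) (slice_coeff i z (a N k) (A N k))
      (slice_boxes i (A N k)) (measure \<omega>)" for N k i z \<omega>
  define W where "W N c = E + (\<Sum>k<N. I N k c)" for N c
  have I_meas[measurable]: "(\<lambda>\<omega>. I N k (measure \<omega>)) \<in> borel_measurable P" for N k
    unfolding I_def by (intro all_moments_measurable all_moments_step_integral boxes)
  have D_meas: "(\<lambda>(z, \<omega>). D N k i z \<omega>) \<in> borel_measurable (\<mu> \<Otimes>\<^sub>M P)" if "i < Suc k" for N k i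
    unfolding D_def by (rule measurable_step_integral_slice[OF boxes that])
  have D_meas': "D N k i z \<in> borel_measurable P" if "i < Suc k" for N k i z
  proof -
    have "step_boxes \<mu> k (M N k) (slice_boxes i (A N k))"
      by (rule step_boxes_slice[OF boxes]) (use that in simp)
    then show ?thesis
      unfolding D_def[abs_def] by (intro all_moments_measurable all_moments_step_integral)
  qed
  have X_meas[measurable]: "X (Suc k) \<in> borel_measurable P" for k
    using mi[of k] by (auto simp: multiple_integral_def converges_L2_def square_integrable_def)
  have F_meas[measurable]: "F \<in> borel_measurable P"
    using conv by (auto simp: converges_L2_def square_integrable_def)
  have W_add: "W N (add_point z (measure \<omega>)) = W N (measure \<omega>) + (\<Sum>(k, i)\<in>S N. D N k i z \<omega>)" for N z \<omega>
    unfolding W_def I_def D_def S_def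
    by (simp only: step_integral_add_point[OF boxes] sum.distrib add.assoc
        sum.Sigma[OF finite_lessThan ballI[OF finite_lessThan], symmetric])
  have W_meas[measurable]: "(\<lambda>\<omega>. W N (measure \<omega>)) \<in> borel_measurable P" for N
    unfolding W_def by measurable
  have W_joint: "(\<lambda>(z, \<omega>). W N (add_point z (measure \<omega>))) \<in> borel_measurable (\<mu> \<Otimes>\<^sub>M P)" for N
  proof -
    have "(\<lambda>w. W N (measure (snd w)) + (\<Sum>(k, i)\<in>S N. D N k i (fst w) (snd w))) \<in> borel_measurable (\<mu> \<Otimes>\<^sub>M P)"
      using D_meas unfolding case_prod_beta'
      by (intro borel_measurable_add borel_measurable_sum) (auto simp: S_def)
    then show ?thesis by (simp add: W_add case_prod_beta')
  qed
  have cylinder: "\<exists>\<B>. finite \<B> \<and> (\<forall>A\<in>\<B>. A \<in> sets \<mu> \<and> emeasure \<mu> A < \<infinity>) \<and> depends_on \<B> (W N)" for N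
  proof (intro exI conjI)
    let ?B = "\<Union>k<N. (\<lambda>(l, i). A N k l i) ` ({..<M N k} \<times> {..<Suc k})"
    show "finite ?B" by auto
    show "\<forall>A\<in>?B. A \<in> sets \<mu> \<and> emeasure \<mu> A < \<infinity>"
      using boxes[of _ N] by (auto simp: step_boxes_def)
    show "depends_on ?B (W N)"
      unfolding depends_on_def
    proof (intro allI impI)
      fix c c' :: "'z set \<Rightarrow> real"
      assume c: "\<forall>A\<in>?B. c A = c' A"
      have "I N k c = I N k c'" if "k < N" for k
      proof -
        have "\<forall>B\<in>(\<lambda>(l, i). A N k l i) ` ({..<M N k} \<times> {..<Suc k}). c B = c' B"
          using c that by blast
        then show ?thesis
          using depends_on_step_integral[of "A N k" "M N k" "Suc k" \<mu> "a N k"]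
          unfolding I_def depends_on_def by blast
      qed
      then show "W N c = W N c'" by (simp add: W_def)
    qed
  qed
  have W_conv: "(\<lambda>N. \<integral>\<^sup>+\<omega>. ennreal ((W N (measure \<omega>) - F \<omega>)\<^sup>2) \<partial>P) \<longlonglongrightarrow> 0"
  proof (rule tendsto_sandwich[OF _ _ tendsto_const])
    let ?T = "\<lambda>N. \<integral>\<^sup>+\<omega>. ennreal (((E + (\<Sum>k<N. X (Suc k) \<omega>)) - F \<omega>)\<^sup>2) \<partial>P"
    show "\<forall>\<^sub>F N in sequentially. (\<integral>\<^sup>+\<omega>. ennreal ((W N (measure \<omega>) - F \<omega>)\<^sup>2) \<partial>P)
        \<le> 2 * ennreal ((1/2) ^ N) + 2 * ?T N"
    proof (intro always_eventually allI)
      fix N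
      have "(\<integral>\<^sup>+\<omega>. ennreal ((W N (measure \<omega>) - (E + (\<Sum>k<N. X (Suc k) \<omega>)))\<^sup>2) \<partial>P)
          = (\<integral>\<^sup>+\<omega>. ennreal ((\<Sum>k<N. I N k (measure \<omega>) - X (Suc k) \<omega>)\<^sup>2) \<partial>P)"
        by (simp add: W_def sum_subtractf)
      also have "\<dots> \<le> of_nat (card {..<N}) * (\<Sum>k<N. \<integral>\<^sup>+\<omega>. ennreal ((I N k (measure \<omega>) - X (Suc k) \<omega>)\<^sup>2) \<partial>P)"
        by (rule nn_integral_square_sum) measurable
      also have "\<dots> \<le> of_nat (card {..<N}) * (\<Sum>k<N. ennreal (e N))"
        unfolding I_def by (intro mult_left_mono sum_mono err_int) auto
      also have "\<dots> = ennreal (real N * (real N * e N))"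
        using e_pos[of N] by (simp add: ennreal_of_nat_eq_real_of_nat flip: ennreal_mult)
      also have "\<dots> \<le> ennreal ((1/2) ^ N)"
      proof (rule ennreal_leI)
        have "0 \<le> real (card (S N)) * (\<Sum>(k, i)\<in>S N. 4 * fact k :: real)"
          by (auto intro!: mult_nonneg_nonneg sum_nonneg)
        then have "real N * real N \<le> R N" by (simp add: R_def)
        then show "real N * (real N * e N) \<le> (1/2) ^ N"
          using R1[of N] by (simp add: e_def field_simps)
      qed
      finally have "(\<integral>\<^sup>+\<omega>. ennreal ((W N (measure \<omega>) - (E + (\<Sum>k<N. X (Suc k) \<omega>)))\<^sup>2) \<partial>P)
          \<le> ennreal ((1/2) ^ N)" .
      moreover have "(\<integral>\<^sup>+\<omega>. ennreal ((W N (measure \<omega>) - F \<omega>)\<^sup>2) \<partial>P)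
          \<le> 2 * (\<integral>\<^sup>+\<omega>. ennreal ((W N (measure \<omega>) - (E + (\<Sum>k<N. X (Suc k) \<omega>)))\<^sup>2) \<partial>P) + 2 * ?T N"
        by (rule nn_integral_square_triangle) measurable
      ultimately show "(\<integral>\<^sup>+\<omega>. ennreal ((W N (measure \<omega>) - F \<omega>)\<^sup>2) \<partial>P)
          \<le> 2 * ennreal ((1/2) ^ N) + 2 * ?T N"
        by (meson add_mono order.trans mult_left_mono order_refl zero_le)
    qed
    have "(\<lambda>N. ennreal ((1/2) ^ N)) \<longlonglongrightarrow> ennreal 0"
      by (intro tendsto_ennrealI LIMSEQ_realpow_zero) auto
    then have "(\<lambda>N. 2 * ennreal ((1/2) ^ N) + 2 * ?T N) \<longlonglongrightarrow> 2 * ennreal 0 + 2 * 0"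
      by (intro tendsto_add ennreal_tendsto_cmult converges_L2_nn_integral conv) auto
    then show "(\<lambda>N. 2 * ennreal ((1/2) ^ N) + 2 * ?T N) \<longlonglongrightarrow> 0" by simp
  qed auto
  define K where "K N k i z = (\<integral>\<^sup>+x. ennreal ((step_kernel (Suc k) (M N k) (a N k) (A N k) (insert_coord i z x)
      - f (Suc k) (insert_coord i z x))\<^sup>2) \<partial>power_measure \<mu> k)" for N k i z
  define h where "h N z = of_nat (card (S N)) * (\<Sum>(k, i)\<in>S N. ennreal (4 * fact k) * K N k i z)" for N z
  have f_meas: "f (Suc k) \<in> borel_measurable (power_measure \<mu> (Suc k))" for k
    using sym[of k] by (auto simp: symmetric_L2_def square_integrable_def)
  have K_meas: "K N k i \<in> borel_measurable \<mu>"
    and K_int: "(\<integral>\<^sup>+z. K N k i z \<partial>\<mu>) \<le> ennreal (e N)" if "i < Suc k" for N k i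
  proof -
    have ik: "i \<le> k" using that by simp
    interpret product_sigma_finite "\<lambda>_::nat. \<mu>" ..
    interpret pow: sigma_finite_measure "power_measure \<mu> k" by (rule sigma_finite) simp
    note [measurable] = f_meas measurable_insert_coord[OF ik] step_kernel_measurable[OF boxes]
    show "K N k i \<in> borel_measurable \<mu>" unfolding K_def[abs_def] by measurable
    show "(\<integral>\<^sup>+z. K N k i z \<partial>\<mu>) \<le> ennreal (e N)"
      unfolding K_def by (subst control.nn_integral_insert_coord[OF ik]) (auto intro: err_ker)
  qed
  have h_meas: "h N \<in> borel_measurable \<mu>" for N
    unfolding h_def[abs_def] using K_meas
    by (intro borel_measurable_times_ennreal borel_measurable_const borel_measurable_sum)
      (auto simp: S_def)
  have h_int: "(\<integral>\<^sup>+z. h N z \<partial>\<mu>) \<le> ennreal ((1/2) ^ N)" for N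
  proof -
    have "(\<integral>\<^sup>+z. h N z \<partial>\<mu>) = of_nat (card (S N)) * (\<integral>\<^sup>+z. (\<Sum>(k, i)\<in>S N. ennreal (4 * fact k) * K N k i z) \<partial>\<mu>)"
      unfolding h_def using K_meas
      by (intro nn_integral_cmult borel_measurable_sum) (auto simp: S_def)
    also have "(\<integral>\<^sup>+z. (\<Sum>(k, i)\<in>S N. ennreal (4 * fact k) * K N k i z) \<partial>\<mu>)
        = (\<Sum>(k, i)\<in>S N. ennreal (4 * fact k) * (\<integral>\<^sup>+z. K N k i z \<partial>\<mu>))"
      using K_meas unfolding case_prod_beta'
      by (subst nn_integral_sum) (auto simp: S_def intro!: nn_integral_cmult sum.cong)
    also have "\<dots> \<le> (\<Sum>(k, i)\<in>S N. ennreal (4 * fact k) * ennreal (e N))"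
      using K_int by (intro sum_mono) (auto simp: S_def intro!: mult_left_mono)
    also have "\<dots> = ennreal ((\<Sum>(k, i)\<in>S N. 4 * fact k) * e N)"
      using e_pos[of N] unfolding sum_distrib_right case_prod_beta'
      by (subst sum_ennreal[symmetric]) (auto intro!: sum.cong simp: ennreal_mult)
    also have "of_nat (card (S N)) * \<dots> = ennreal (real (card (S N)) * (\<Sum>(k, i)\<in>S N. 4 * fact k) * e N)"
      using e_pos[of N] unfolding ennreal_of_nat_eq_real_of_nat
      by (subst ennreal_mult[symmetric]) (auto intro!: mult_nonneg_nonneg sum_nonneg simp: mult.assoc)
    also have "\<dots> \<le> ennreal ((1/2) ^ N)"
    proof (rule ennreal_leI)
      have "real (card (S N)) * (\<Sum>(k, i)\<in>S N. 4 * fact k) \<le> R N"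
        by (simp add: R_def)
      then have "real (card (S N)) * (\<Sum>(k, i)\<in>S N. 4 * fact k) * e N \<le> R N * e N"
        using e_pos[of N] by (intro mult_right_mono) auto
      then show "real (card (S N)) * (\<Sum>(k, i)\<in>S N. 4 * fact k) * e N \<le> (1/2) ^ N"
        using R1[of N] by (simp add: e_def)
    qed
    finally show ?thesis by (simp add: mult_left_mono)
  qed
  have h_lim: "AE z in \<mu>. (\<lambda>N. h N z) \<longlonglongrightarrow> 0"
    using h_meas h_int by (rule AE_tendsto_zero_of_summable)
  have sym_ae: "AE z in \<mu>. \<forall>k. \<forall>i\<in>{..<Suc k}. AE x in power_measure \<mu> k.
      f (Suc k) (insert_coord i z x) = f (Suc k) (insert_coord 0 z x)"
    unfolding AE_all_countable
    by (intro allI AE_finite_allI control.symmetric_insert_coord[OF sym]) auto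
  have W_der: "AE z in \<mu>. (\<lambda>N. \<integral>\<^sup>+\<omega>. ennreal ((W N (add_point z (measure \<omega>)) - W N (measure \<omega>) - U z \<omega>)\<^sup>2) \<partial>P)
      \<longlonglongrightarrow> 0"
    using der h_lim sym_ae
  proof eventually_elim
    case (elim z)
    then obtain Y where Y: "\<And>k. multiple_integral \<mu> P k (\<lambda>x. f (Suc k) (case_nat z x)) (Y k)"
      and U: "converges_L2 P (\<lambda>N \<omega>. \<Sum>k<N. real (Suc k) * Y k \<omega>) (U z)" by blast
    have [measurable]: "Y k \<in> borel_measurable P" "U z \<in> borel_measurable P" for k
      using Y[of k] U by (auto simp: multiple_integral_def converges_L2_def square_integrable_def)
    let ?T = "\<lambda>N. \<integral>\<^sup>+\<omega>. ennreal (((\<Sum>k<N. real (Suc k) * Y k \<omega>) - U z \<omega>)\<^sup>2) \<partial>P"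
    have term_bound: "(\<integral>\<^sup>+\<omega>. ennreal ((D N k i z \<omega> - Y k \<omega>)\<^sup>2) \<partial>P) \<le> ennreal (4 * fact k) * K N k i z"
      if i: "i < Suc k" for N k i
    proof -
      have ik: "i \<le> k" using i by simp
      have "(\<integral>\<^sup>+\<omega>. ennreal ((D N k i z \<omega> - Y k \<omega>)\<^sup>2) \<partial>P)
          \<le> ennreal (4 * fact k) * (\<integral>\<^sup>+x. ennreal ((step_kernel k (M N k) (slice_coeff i z (a N k) (A N k))
            (slice_boxes i (A N k)) x - f (Suc k) (case_nat z x))\<^sup>2) \<partial>power_measure \<mu> k)"
        unfolding D_def by (intro multiple_integral_distance step_boxes_slice[OF boxes ik] Y)
      also have "(\<integral>\<^sup>+x. ennreal ((step_kernel k (M N k) (slice_coeff i z (a N k) (A N k))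
            (slice_boxes i (A N k)) x - f (Suc k) (case_nat z x))\<^sup>2) \<partial>power_measure \<mu> k) = K N k i z"
        unfolding K_def
      proof (rule nn_integral_cong_AE)
        have "AE x in power_measure \<mu> k. f (Suc k) (insert_coord i z x) = f (Suc k) (insert_coord 0 z x)"
          using elim(3) i by blast
        then show "AE x in power_measure \<mu> k. ennreal ((step_kernel k (M N k) (slice_coeff i z (a N k) (A N k))
            (slice_boxes i (A N k)) x - f (Suc k) (case_nat z x))\<^sup>2)
          = ennreal ((step_kernel (Suc k) (M N k) (a N k) (A N k) (insert_coord i z x)
            - f (Suc k) (insert_coord i z x))\<^sup>2)"
          using AE_space
        proof eventually_elim
          case (elim x)
          then have "x \<in> extensional {..<k}" by (simp add: space_PiM PiE_def)
          then show ?case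
            using elim(1) by (simp add: step_kernel_insert_coord[OF ik] insert_coord_0)
        qed
      qed
      finally show ?thesis .
    qed
    show ?case
    proof (rule tendsto_sandwich[OF _ _ tendsto_const])
      show "\<forall>\<^sub>F N in sequentially.
          (\<integral>\<^sup>+\<omega>. ennreal ((W N (add_point z (measure \<omega>)) - W N (measure \<omega>) - U z \<omega>)\<^sup>2) \<partial>P)
          \<le> 2 * h N z + 2 * ?T N"
      proof (intro always_eventually allI)
        fix N
        have Y_sum: "(\<Sum>k<N. real (Suc k) * Y k \<omega>) = (\<Sum>(k, i)\<in>S N. Y k \<omega>)" for \<omega>
          unfolding S_def by (subst sum.Sigma[symmetric]) auto
        have meas1: "(\<lambda>\<omega>. D N (fst s) (snd s) z \<omega> - Y (fst s) \<omega>) \<in> borel_measurable P" if "s \<in> S N" for s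
          using D_meas' that by (auto simp: S_def)
        have meas2: "(\<lambda>\<omega>. \<Sum>(k, i)\<in>S N. D N k i z \<omega>) \<in> borel_measurable P"
          using D_meas' unfolding case_prod_beta' by (intro borel_measurable_sum) (auto simp: S_def)
        have "(\<integral>\<^sup>+\<omega>. ennreal (((\<Sum>(k, i)\<in>S N. D N k i z \<omega>) - (\<Sum>k<N. real (Suc k) * Y k \<omega>))\<^sup>2) \<partial>P)
            = (\<integral>\<^sup>+\<omega>. ennreal ((\<Sum>s\<in>S N. D N (fst s) (snd s) z \<omega> - Y (fst s) \<omega>)\<^sup>2) \<partial>P)"
          unfolding Y_sum case_prod_beta' sum_subtractf ..
        also have "\<dots> \<le> of_nat (card (S N)) *
            (\<Sum>s\<in>S N. \<integral>\<^sup>+\<omega>. ennreal ((D N (fst s) (snd s) z \<omega> - Y (fst s) \<omega>)\<^sup>2) \<partial>P)"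
          by (rule nn_integral_square_sum[OF meas1])
        also have "\<dots> \<le> h N z"
          unfolding h_def case_prod_beta'
          by (intro mult_left_mono sum_mono term_bound) (auto simp: S_def)
        finally have "(\<integral>\<^sup>+\<omega>. ennreal (((\<Sum>(k, i)\<in>S N. D N k i z \<omega>)
            - (\<Sum>k<N. real (Suc k) * Y k \<omega>))\<^sup>2) \<partial>P) \<le> h N z" .
        moreover have "(\<integral>\<^sup>+\<omega>. ennreal (((\<Sum>(k, i)\<in>S N. D N k i z \<omega>) - U z \<omega>)\<^sup>2) \<partial>P)
            \<le> 2 * (\<integral>\<^sup>+\<omega>. ennreal (((\<Sum>(k, i)\<in>S N. D N k i z \<omega>)
              - (\<Sum>k<N. real (Suc k) * Y k \<omega>))\<^sup>2) \<partial>P) + 2 * ?T N"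
          by (rule nn_integral_square_triangle[OF meas2]) measurable
        ultimately have "(\<integral>\<^sup>+\<omega>. ennreal (((\<Sum>(k, i)\<in>S N. D N k i z \<omega>) - U z \<omega>)\<^sup>2) \<partial>P)
            \<le> 2 * h N z + 2 * ?T N"
          by (meson add_mono order.trans mult_left_mono order_refl zero_le)
        then show "(\<integral>\<^sup>+\<omega>. ennreal ((W N (add_point z (measure \<omega>)) - W N (measure \<omega>) - U z \<omega>)\<^sup>2) \<partial>P)
            \<le> 2 * h N z + 2 * ?T N"
          by (simp add: W_add)
      qed
      have "(\<lambda>N. 2 * h N z + 2 * ?T N) \<longlonglongrightarrow> 2 * 0 + 2 * 0"
        by (intro tendsto_add ennreal_tendsto_cmult elim(2) converges_L2_nn_integral U) auto
      then show "(\<lambda>N. 2 * h N z + 2 * ?T N) \<longlonglongrightarrow> 0" by simp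
    qed auto
  qed
  show ?thesis
    using cylinder W_meas W_joint W_conv W_der by blast
qed

section \<open>The derivative of an integer valued functional\<close>

lemma abs_cos_diff_le: "\<bar>cos x - cos y\<bar> \<le> \<bar>x - y\<bar>" for x y :: real
proof -
  have "\<bar>cos x - cos y\<bar> = 2 * \<bar>sin ((x + y) / 2)\<bar> * \<bar>sin ((y - x) / 2)\<bar>"
    by (simp add: cos_diff_cos abs_mult)
  also have "\<dots> \<le> 2 * 1 * \<bar>(y - x) / 2\<bar>"
    by (intro mult_mono abs_sin_x_le_abs_x) auto
  finally show ?thesis by simp
qed

text \<open>
  The cosine is Lipschitz continuous, so the claim follows from the Cauchy-Schwarz inequality.
\<close>

lemma integral_weighted_cos_tendsto:
  fixes Y X :: "'a \<Rightarrow> real"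
  assumes Y: "integrable M Y" "integrable M (\<lambda>x. (Y x)\<^sup>2)"
    and [measurable]: "\<And>n. Xs n \<in> borel_measurable M" "X \<in> borel_measurable M"
    and conv: "(\<lambda>n. \<integral>\<^sup>+x. ennreal ((Xs n x - X x)\<^sup>2) \<partial>M) \<longlonglongrightarrow> 0"
  shows "(\<lambda>n. LINT x|M. Y x * cos (2 * pi * Xs n x)) \<longlonglongrightarrow> (LINT x|M. Y x * cos (2 * pi * X x))"
proof -
  have [measurable]: "Y \<in> borel_measurable M" using Y by auto
  have int: "integrable M (\<lambda>x. Y x * cos (2 * pi * Z x))" if [measurable]: "Z \<in> borel_measurable M" for Z
  proof (rule Bochner_Integration.integrable_bound[OF Y(1)])
    show "AE x in M. norm (Y x * cos (2 * pi * Z x)) \<le> norm (Y x)"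
      by (auto simp: abs_mult mult_left_le)
  qed measurable
  let ?g = "\<lambda>n x. cos (2 * pi * Xs n x) - cos (2 * pi * X x)"
  let ?J = "\<lambda>n. LINT x|M. Y x * ?g n x"
  have J: "?J n = (LINT x|M. Y x * cos (2 * pi * Xs n x)) - (LINT x|M. Y x * cos (2 * pi * X x))" for n
    by (simp add: right_diff_distrib int)
  let ?C = "\<integral>\<^sup>+x. ennreal ((Y x)\<^sup>2) \<partial>M"
  let ?e = "\<lambda>n. \<integral>\<^sup>+x. ennreal ((Xs n x - X x)\<^sup>2) \<partial>M"
  have C: "?C < \<top>" using Y(2) by (simp add: integrable_iff_bounded)
  have bound: "ennreal ((?J n)\<^sup>2) \<le> ?C * (ennreal ((2 * pi)\<^sup>2) * ?e n)" for n
  proof -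
    have "ennreal \<bar>?J n\<bar> \<le> (\<integral>\<^sup>+x. ennreal (norm (Y x * ?g n x)) \<partial>M)"
      using integral_norm_bound_ennreal[of M "\<lambda>x. Y x * ?g n x"] int[of "Xs n"] int[of X]
      by (simp add: right_diff_distrib)
    also have "\<dots> = (\<integral>\<^sup>+x. ennreal \<bar>Y x\<bar> * ennreal \<bar>?g n x\<bar> \<partial>M)"
      by (simp add: abs_mult ennreal_mult)
    finally have "(ennreal \<bar>?J n\<bar>)\<^sup>2 \<le> (\<integral>\<^sup>+x. ennreal \<bar>Y x\<bar> * ennreal \<bar>?g n x\<bar> \<partial>M)\<^sup>2"
      by (rule power_mono) simp
    also have "\<dots> \<le> (\<integral>\<^sup>+x. (ennreal \<bar>Y x\<bar>)\<^sup>2 \<partial>M) * (\<integral>\<^sup>+x. (ennreal \<bar>?g n x\<bar>)\<^sup>2 \<partial>M)"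
      by (rule Cauchy_Schwarz_nn_integral) measurable
    also have "\<dots> = ?C * (\<integral>\<^sup>+x. ennreal ((?g n x)\<^sup>2) \<partial>M)"
      by (simp add: ennreal_power)
    also have "(\<integral>\<^sup>+x. ennreal ((?g n x)\<^sup>2) \<partial>M) \<le> (\<integral>\<^sup>+x. ennreal ((2 * pi)\<^sup>2) * ennreal ((Xs n x - X x)\<^sup>2) \<partial>M)"
    proof (rule nn_integral_mono)
      fix x
      have "\<bar>?g n x\<bar> \<le> \<bar>2 * pi * (Xs n x - X x)\<bar>"
        using abs_cos_diff_le[of "2 * pi * Xs n x" "2 * pi * X x"] by (simp add: right_diff_distrib)
      then have "(?g n x)\<^sup>2 \<le> (2 * pi)\<^sup>2 * (Xs n x - X x)\<^sup>2"
        by (simp only: abs_le_square_iff power_mult_distrib)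
      then show "ennreal ((?g n x)\<^sup>2) \<le> ennreal ((2 * pi)\<^sup>2) * ennreal ((Xs n x - X x)\<^sup>2)"
        by (subst ennreal_mult[symmetric]) (auto intro: ennreal_leI)
    qed
    also have "\<dots> = ennreal ((2 * pi)\<^sup>2) * ?e n" by (rule nn_integral_cmult) measurable
    finally show ?thesis by (simp add: ennreal_power mult_left_mono)
  qed
  have "(\<lambda>n. ?C * (ennreal ((2 * pi)\<^sup>2) * ?e n)) \<longlonglongrightarrow> ?C * (ennreal ((2 * pi)\<^sup>2) * 0)"
    using C by (intro ennreal_tendsto_cmult conv) auto
  then have "(\<lambda>n. ?C * (ennreal ((2 * pi)\<^sup>2) * ?e n)) \<longlonglongrightarrow> 0" by simp
  then have "(\<lambda>n. ennreal ((?J n)\<^sup>2)) \<longlonglongrightarrow> 0"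
    by (rule tendsto_sandwich[OF _ _ tendsto_const, rotated 2]) (intro always_eventually allI zero_le bound)+
  then have "(\<lambda>n. (?J n)\<^sup>2) \<longlonglongrightarrow> 0" by (subst (asm) ennreal_tendsto_0_iff) auto
  then have "(\<lambda>n. sqrt ((?J n)\<^sup>2)) \<longlonglongrightarrow> sqrt 0" by (rule tendsto_real_sqrt)
  then have "?J \<longlonglongrightarrow> 0" by (simp add: tendsto_rabs_zero_iff)
  then show ?thesis unfolding J by (simp add: LIM_zero_iff)
qed

text \<open>
  Let \<open>W\<^sub>n\<close> approximate \<open>F\<close> together with its derivative, and let \<open>\<mu>(B)\<close> be finite. The Mecke formula
  for the functional \<open>cos(2\<pi>W\<^sub>n)\<close> of finitely many counts reads
  \<open>E[\<omega>(B) cos(2\<pi>W\<^sub>n(\<omega>))] = \<integral>\<^sub>B E[cos(2\<pi>W\<^sub>n(\<omega> + \<delta>\<^sub>z))] \<mu>(dz)\<close>.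
  In the limit \<open>W\<^sub>n(\<omega>)\<close> becomes the integer \<open>F\<close> and \<open>W\<^sub>n(\<omega> + \<delta>\<^sub>z)\<close> becomes \<open>F + U\<^sub>z\<close>, which leaves
  \<open>\<mu>(B) = \<integral>\<^sub>B E[cos(2\<pi>U\<^sub>z)] \<mu>(dz)\<close>.
  A function bounded by \<open>1\<close> whose integral is that of \<open>1\<close> equals \<open>1\<close> almost everywhere, so \<open>U\<^sub>z\<close> is an
  integer. This passage to the limit takes the place of the identity
  \<open>U\<^sub>z(\<omega>) = F(\<omega> + \<delta>\<^sub>z) - F(\<omega>)\<close> for general \<open>F\<close>.
\<close>

lemma (in poisson_space) derivative_integer:
  assumes der: "malliavin_derivative \<mu> P F U" and F: "AE \<omega> in P. F \<omega> \<in> \<nat>"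
  shows "AE \<omega> in P. AE z in \<mu>. U z \<omega> \<in> \<int>"
proof -
  have U[measurable]: "(\<lambda>(z, \<omega>). U z \<omega>) \<in> borel_measurable (\<mu> \<Otimes>\<^sub>M P)"
    using der by (simp add: malliavin_derivative_def)
  have F_meas[measurable]: "F \<in> borel_measurable P"
    using der by (auto simp: malliavin_derivative_def chaotic_decomposition_def converges_L2_def
        square_integrable_def)
  obtain W where cyl: "\<And>n. \<exists>\<B>. finite \<B> \<and> (\<forall>A\<in>\<B>. A \<in> sets \<mu> \<and> emeasure \<mu> A < \<infinity>) \<and> depends_on \<B> (W n)"
    and [measurable]: "\<And>n. (\<lambda>\<omega>. W n (measure \<omega>)) \<in> borel_measurable P"
    and joint[measurable]: "\<And>n. (\<lambda>(z, \<omega>). W n (add_point z (measure \<omega>))) \<in> borel_measurable (\<mu> \<Otimes>\<^sub>M P)"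
    and W_F: "(\<lambda>n. \<integral>\<^sup>+\<omega>. ennreal ((W n (measure \<omega>) - F \<omega>)\<^sup>2) \<partial>P) \<longlonglongrightarrow> 0"
    and W_U: "AE z in \<mu>. (\<lambda>n. \<integral>\<^sup>+\<omega>. ennreal ((W n (add_point z (measure \<omega>)) - W n (measure \<omega>) - U z \<omega>)\<^sup>2) \<partial>P)
      \<longlonglongrightarrow> 0"
    using derivative_approximation[OF der] by blast
  \<comment> \<open>The sine is needed for \<open>cos(2\<pi>(F + U\<^sub>z)) = cos(2\<pi>U\<^sub>z)\<close>.\<close>
  have cos_F: "AE \<omega> in P. cos (2 * pi * F \<omega>) = 1 \<and> sin (2 * pi * F \<omega>) = 0"
    using F
  proof eventually_elim
    case (elim \<omega>)
    then obtain n where "F \<omega> = real n" by (auto elim: Nats_cases)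
    then show ?case using cos_2npi[of n] sin_2npi[of n] by (simp add: mult_ac)
  qed
  have local: "AE z in \<mu>. z \<in> B \<longrightarrow> (AE \<omega> in P. U z \<omega> \<in> \<int>)"
    if B: "B \<in> sets \<mu>" "emeasure \<mu> B < \<infinity>" for B
  proof -
    note [measurable] = B(1)
    have mom: "all_moments P (\<lambda>\<omega>. measure \<omega> B)" by (rule all_moments_evaluation[OF B])
    have m_int: "integrable P (\<lambda>\<omega>. measure \<omega> B)" by (rule all_moments_integrable[OF mom])
    \<comment> \<open>The inner expectations of the Mecke formula and their limit.\<close>
    define r where "r n z = (LINT \<omega>|P. cos (2 * pi * W n (add_point z (measure \<omega>))))" for n z
    define r' where "r' z = (LINT \<omega>|P. cos (2 * pi * U z \<omega>))" for z
    have r_meas[measurable]: "r n \<in> borel_measurable \<mu>" "r' \<in> borel_measurable \<mu>" for n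
      unfolding r_def[abs_def] r'_def[abs_def] by measurable
    have r_eq: "(LINT z|\<mu>. indicator B z * r n z) = (LINT \<omega>|P. measure \<omega> B * cos (2 * pi * W n (measure \<omega>)))" for n
    proof -
      obtain \<B> where \<B>: "finite \<B>" "\<forall>A\<in>\<B>. A \<in> sets \<mu> \<and> emeasure \<mu> A < \<infinity>" "depends_on \<B> (W n)"
        using cyl[of n] by blast
      have dep: "depends_on (insert B \<B>) (\<lambda>c. cos (2 * pi * W n c))"
        using \<B>(3) unfolding depends_on_def by (metis insertI2)
      have int: "integrable P (\<lambda>\<omega>. measure \<omega> B * cos (2 * pi * W n (measure \<omega>)))"
        by (rule Bochner_Integration.integrable_bound[OF m_int]) (auto simp: abs_mult mult_left_le)
      note mecke = mecke_cylinder_integral[of "insert B \<B>" B "\<lambda>c. cos (2 * pi * W n c)"]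
      have joint': "(\<lambda>(z, \<omega>). cos (2 * pi * W n (add_point z (measure \<omega>)))) \<in> borel_measurable (\<mu> \<Otimes>\<^sub>M P)"
        by measurable
      have pint: "integrable (\<mu> \<Otimes>\<^sub>M P) (\<lambda>(z, \<omega>). indicator B z * cos (2 * pi * W n (add_point z (measure \<omega>))))"
        by (rule mecke(1)) (use \<B> B dep int joint' in auto)
      have "(LINT z|\<mu>. indicator B z * r n z) = (LINT z|\<mu>. LINT \<omega>|P.
          (case (z, \<omega>) of (z, \<omega>) \<Rightarrow> indicator B z * cos (2 * pi * W n (add_point z (measure \<omega>)))))"
        by (simp add: r_def)
      also have "\<dots> = (LINT (z, \<omega>)|(\<mu> \<Otimes>\<^sub>M P). indicator B z * cos (2 * pi * W n (add_point z (measure \<omega>))))"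
        by (rule pair.integral_fst'[OF pint])
      also have "\<dots> = (LINT \<omega>|P. measure \<omega> B * cos (2 * pi * W n (measure \<omega>)))"
        by (rule mecke(2)) (use \<B> B dep int joint' in auto)
      finally show ?thesis .
    qed
    have r_bound: "\<bar>r n z\<bar> \<le> 1" "\<bar>r' z\<bar> \<le> 1" for n z
    proof -
      have "\<bar>LINT \<omega>|P. cos (g \<omega>)\<bar> \<le> 1" for g :: "'z measure \<Rightarrow> real"
      proof (cases "integrable P (\<lambda>\<omega>. cos (g \<omega>))")
        case True
        have "\<bar>LINT \<omega>|P. cos (g \<omega>)\<bar> \<le> (LINT \<omega>|P. \<bar>cos (g \<omega>)\<bar>)" by (rule integral_abs_bound)
        also have "\<dots> \<le> (LINT \<omega>|P. 1)" using True by (intro integral_mono) auto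
        finally show ?thesis by (simp add: P.prob_space)
      qed (simp add: not_integrable_integral_eq)
      then show "\<bar>r n z\<bar> \<le> 1" "\<bar>r' z\<bar> \<le> 1" by (auto simp: r_def r'_def)
    qed
    have r_lim: "AE z in \<mu>. (\<lambda>n. r n z) \<longlonglongrightarrow> r' z"
      using W_U AE_space
    proof eventually_elim
      case (elim z)
      have [measurable]: "U z \<in> borel_measurable P"
        using measurable_Pair2[OF U elim(2)] by simp
      have [measurable]: "(\<lambda>\<omega>. W n (add_point z (measure \<omega>))) \<in> borel_measurable P" for n
        using measurable_Pair2[OF joint elim(2)] by simp
      let ?d = "\<lambda>n. \<integral>\<^sup>+\<omega>. ennreal ((W n (add_point z (measure \<omega>)) - W n (measure \<omega>) - U z \<omega>)\<^sup>2) \<partial>P"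
      let ?e = "\<lambda>n. \<integral>\<^sup>+\<omega>. ennreal ((W n (measure \<omega>) - F \<omega>)\<^sup>2) \<partial>P"
      have sq: "(\<integral>\<^sup>+\<omega>. ennreal ((W n (add_point z (measure \<omega>)) - (F \<omega> + U z \<omega>))\<^sup>2) \<partial>P) \<le> 2 * ?d n + 2 * ?e n" for n
      proof -
        have "(\<integral>\<^sup>+\<omega>. ennreal ((W n (add_point z (measure \<omega>)) - (F \<omega> + U z \<omega>))\<^sup>2) \<partial>P)
            \<le> 2 * (\<integral>\<^sup>+\<omega>. ennreal ((W n (add_point z (measure \<omega>)) - (W n (measure \<omega>) + U z \<omega>))\<^sup>2) \<partial>P)
              + 2 * (\<integral>\<^sup>+\<omega>. ennreal (((W n (measure \<omega>) + U z \<omega>) - (F \<omega> + U z \<omega>))\<^sup>2) \<partial>P)"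
          by (rule nn_integral_square_triangle) measurable
        then show ?thesis by (simp add: diff_diff_eq)
      qed
      have "(\<lambda>n. 2 * ?d n + 2 * ?e n) \<longlonglongrightarrow> 2 * 0 + 2 * 0"
        by (intro tendsto_add ennreal_tendsto_cmult elim(1) W_F) auto
      then have "(\<lambda>n. 2 * ?d n + 2 * ?e n) \<longlonglongrightarrow> 0" by simp
      then have "(\<lambda>n. \<integral>\<^sup>+\<omega>. ennreal ((W n (add_point z (measure \<omega>)) - (F \<omega> + U z \<omega>))\<^sup>2) \<partial>P) \<longlonglongrightarrow> 0"
        by (rule tendsto_sandwich[OF _ _ tendsto_const, rotated 2]) (intro always_eventually allI zero_le sq)+
      then have "(\<lambda>n. LINT \<omega>|P. 1 * cos (2 * pi * W n (add_point z (measure \<omega>))))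
          \<longlonglongrightarrow> (LINT \<omega>|P. 1 * cos (2 * pi * (F \<omega> + U z \<omega>)))"
        by (intro integral_weighted_cos_tendsto) auto
      moreover have "(LINT \<omega>|P. cos (2 * pi * (F \<omega> + U z \<omega>))) = r' z"
        unfolding r'_def
      proof (rule integral_cong_AE)
        show "AE \<omega> in P. cos (2 * pi * (F \<omega> + U z \<omega>)) = cos (2 * pi * U z \<omega>)"
          using cos_F by eventually_elim (simp add: distrib_left cos_add)
      qed measurable
      ultimately show ?case by (simp add: r_def)
    qed
    have ind_int: "integrable \<mu> (indicator B :: 'z \<Rightarrow> real)"
      using B by (intro integrable_real_indicator) auto
    have "(\<lambda>n. LINT z|\<mu>. indicator B z * r n z) \<longlonglongrightarrow> (LINT z|\<mu>. indicator B z * r' z)"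
    proof (rule integral_dominated_convergence[OF _ _ ind_int])
      show "AE z in \<mu>. (\<lambda>n. indicator B z * r n z) \<longlonglongrightarrow> indicator B z * r' z"
        using r_lim by eventually_elim (intro tendsto_mult tendsto_const)
      show "AE z in \<mu>. norm (indicator B z * r n z) \<le> indicator B z" for n
        using r_bound by (auto simp: indicator_def)
    qed measurable
    moreover have "(\<lambda>n. LINT \<omega>|P. measure \<omega> B * cos (2 * pi * W n (measure \<omega>)))
        \<longlonglongrightarrow> (LINT \<omega>|P. measure \<omega> B * cos (2 * pi * F \<omega>))"
      using W_F by (intro integral_weighted_cos_tendsto m_int all_moments_square[OF mom]) auto
    ultimately have "(LINT z|\<mu>. indicator B z * r' z) = (LINT \<omega>|P. measure \<omega> B * cos (2 * pi * F \<omega>))"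
      unfolding r_eq by (rule LIMSEQ_unique)
    also have "\<dots> = (LINT \<omega>|P. measure \<omega> B)"
    proof (rule integral_cong_AE)
      show "AE \<omega> in P. measure \<omega> B * cos (2 * pi * F \<omega>) = measure \<omega> B"
        using cos_F by eventually_elim simp
    qed measurable
    also have "\<dots> = measure \<mu> B"
    proof -
      have "ennreal (LINT \<omega>|P. measure \<omega> B) = (\<integral>\<^sup>+\<omega>. ennreal (measure \<omega> B) * 1 \<partial>P)"
        using m_int by (simp add: nn_integral_eq_integral)
      also have "\<dots> = (\<integral>\<^sup>+z. indicator B z * (\<integral>\<^sup>+\<omega>. 1 \<partial>P) \<partial>\<mu>)"
        by (rule mecke_cylinder[of "{B}"]) (use B in \<open>auto simp: depends_on_def\<close>)
      also have "\<dots> = ennreal (measure \<mu> B)"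
        using B by (simp add: P.emeasure_space_1 emeasure_eq_ennreal_measure)
      finally show ?thesis by (subst (asm) ennreal_inj) auto
    qed
    finally have total: "(LINT z|\<mu>. indicator B z * r' z) = measure \<mu> B" .
    have r'_int: "integrable \<mu> (\<lambda>z. indicator B z * r' z)"
      by (rule Bochner_Integration.integrable_bound[OF ind_int]) (use r_bound in \<open>auto simp: indicator_def\<close>)
    have "(LINT z|\<mu>. indicator B z - indicator B z * r' z) = 0"
      using total B ind_int r'_int by simp
    moreover have "integrable \<mu> (\<lambda>z. indicator B z - indicator B z * r' z)"
      using ind_int r'_int by simp
    moreover have "AE z in \<mu>. 0 \<le> indicator B z - indicator B z * r' z"
      using r_bound(2) by (auto simp: indicator_def abs_le_iff)
    ultimately have "AE z in \<mu>. indicator B z - indicator B z * r' z = (0::real)"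
      by (simp only: integral_nonneg_eq_0_iff_AE)
    then show ?thesis
      using AE_space
    proof eventually_elim
      case (elim z)
      show ?case
      proof
        assume "z \<in> B"
        then have r1: "r' z = 1" using elim by simp
        have [measurable]: "U z \<in> borel_measurable P"
          using measurable_Pair2[OF U elim(2)] by simp
        have int: "integrable P (\<lambda>\<omega>. cos (2 * pi * U z \<omega>))"
          by (rule P.integrable_const_bound[of _ 1]) auto
        then have "(LINT \<omega>|P. 1 - cos (2 * pi * U z \<omega>)) = 0"
          using r1 by (simp add: r'_def P.prob_space)
        then have "AE \<omega> in P. 1 - cos (2 * pi * U z \<omega>) = 0"
          using int by (subst (asm) integral_nonneg_eq_0_iff_AE) auto
        then show "AE \<omega> in P. U z \<omega> \<in> \<int>"
        proof eventually_elim
          case (elim \<omega>)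
          then obtain n :: int where "2 * pi * U z \<omega> = n * 2 * pi"
            using cos_one_2pi_int[of "2 * pi * U z \<omega>"] by auto
          then have "U z \<omega> = of_int n" by simp
          then show ?case by simp
        qed
      qed
    qed
  qed
  obtain A :: "nat \<Rightarrow> 'z set" where A: "range A \<subseteq> sets \<mu>" "(\<Union>i. A i) = space \<mu>" "\<And>i. emeasure \<mu> (A i) \<noteq> \<infinity>"
    by (rule control.sigma_finite) (rule that)
  have "AE z in \<mu>. \<forall>i. z \<in> A i \<longrightarrow> (AE \<omega> in P. U z \<omega> \<in> \<int>)"
    unfolding AE_all_countable using A by (intro allI local) (auto simp: less_top)
  then have "AE z in \<mu>. AE \<omega> in P. U z \<omega> \<in> \<int>"
    using AE_space by eventually_elim (use A(2) in blast)
  moreover have "{x \<in> space (\<mu> \<Otimes>\<^sub>M P). U (fst x) (snd x) \<in> \<int>} \<in> sets (\<mu> \<Otimes>\<^sub>M P)"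
  proof -
    have "(\<lambda>x. U (fst x) (snd x)) \<in> borel_measurable (\<mu> \<Otimes>\<^sub>M P)"
      using U by (simp add: case_prod_beta')
    moreover have "(\<int> :: real set) \<in> sets borel" by (intro borel_closed closed_Ints)
    ultimately have "(\<lambda>x. U (fst x) (snd x)) -` \<int> \<inter> space (\<mu> \<Otimes>\<^sub>M P) \<in> sets (\<mu> \<Otimes>\<^sub>M P)"
      by (rule measurable_sets)
    then show ?thesis by (simp add: vimage_def Int_def conj_commute)
  qed
  ultimately show ?thesis by (simp add: pair.AE_commute)
qed

section \<open>Decay of the mixed term\<close>

text \<open>
  If \<open>|v| \<le> \<delta>|u|\<close>, the first term on the right is large enough. Otherwise \<open>u \<noteq> 0\<close> gives
  \<open>|v| > \<delta>|u| \<ge> \<delta>\<close>; then \<open>|v||u| \<le> v\<^sup>2/\<delta>\<close>, and as \<open>|v|/\<delta> \<ge> 1\<close> the exponent \<open>2\<close> may be raised to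
  \<open>1 + \<epsilon>\<close>. The bound \<open>|u| \<ge> 1\<close> for nonzero integers is what makes an exponent above \<open>2\<close> usable.
\<close>

lemma product_le_of_integer:
  fixes u v \<delta> \<epsilon> :: real
  assumes u: "u \<in> \<int>" and \<delta>: "0 < \<delta>" and \<epsilon>: "1 < \<epsilon>"
  shows "\<bar>v\<bar> * \<bar>u\<bar> \<le> \<delta> * u\<^sup>2 + \<delta> powr (- \<epsilon>) * \<bar>v\<bar> powr (1 + \<epsilon>)"
proof (cases "u = 0 \<or> \<bar>v\<bar> \<le> \<delta> * \<bar>u\<bar>")
  case True
  then have "\<bar>v\<bar> * \<bar>u\<bar> \<le> \<delta> * u\<^sup>2"
    using mult_right_mono[of "\<bar>v\<bar>" "\<delta> * \<bar>u\<bar>" "\<bar>u\<bar>"] by (auto simp: power2_eq_square mult.assoc)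
  then show ?thesis by (simp add: add_increasing2)
next
  case False
  then have u1: "1 \<le> \<bar>u\<bar>" using u Ints_nonzero_abs_ge1 by blast
  have v: "\<delta> * \<bar>u\<bar> < \<bar>v\<bar>" using False by simp
  have "\<delta> \<le> \<delta> * \<bar>u\<bar>" using u1 \<delta> by simp
  then have v\<delta>: "\<delta> \<le> \<bar>v\<bar>" using v by linarith
  then have v0: "0 < \<bar>v\<bar>" using \<delta> by linarith
  have "\<bar>v\<bar> * \<bar>u\<bar> \<le> \<bar>v\<bar> * (\<bar>v\<bar> / \<delta>)"
    using v \<delta> by (intro mult_left_mono) (auto simp: field_simps)
  also have "\<dots> = \<delta> powr (- 1) * \<bar>v\<bar> powr 2"
    using \<delta> v0 by (simp add: powr_minus_divide powr_numeral power2_eq_square)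
  also have "\<dots> \<le> \<delta> powr (- \<epsilon>) * \<bar>v\<bar> powr (1 + \<epsilon>)"
  proof -
    have "\<delta> powr (\<epsilon> - 1) \<le> \<bar>v\<bar> powr (\<epsilon> - 1)" using v\<delta> \<delta> \<epsilon> by (intro powr_mono2) auto
    then have "\<delta> powr (- \<epsilon>) * \<bar>v\<bar> powr 2 * \<delta> powr (\<epsilon> - 1)
        \<le> \<delta> powr (- \<epsilon>) * \<bar>v\<bar> powr 2 * \<bar>v\<bar> powr (\<epsilon> - 1)"
      by (intro mult_left_mono) auto
    moreover have "\<delta> powr (- \<epsilon>) * \<bar>v\<bar> powr 2 * \<delta> powr (\<epsilon> - 1) = \<delta> powr (- 1) * \<bar>v\<bar> powr 2"
      using powr_add[of \<delta> "- \<epsilon>" "\<epsilon> - 1"] by (simp add: mult_ac)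
    moreover have "\<delta> powr (- \<epsilon>) * \<bar>v\<bar> powr 2 * \<bar>v\<bar> powr (\<epsilon> - 1) = \<delta> powr (- \<epsilon>) * \<bar>v\<bar> powr (1 + \<epsilon>)"
      using powr_add[of "\<bar>v\<bar>" 2 "\<epsilon> - 1"] by (simp add: mult_ac add_ac)
    ultimately show ?thesis by metis
  qed
  finally show ?thesis using \<delta> by (simp add: add_increasing)
qed

lemma (in poisson_space) nn_integral_product_le:
  fixes u v :: "'z \<Rightarrow> 'z measure \<Rightarrow> real"
  assumes [measurable]: "(\<lambda>(z, \<omega>). u z \<omega>) \<in> borel_measurable (\<mu> \<Otimes>\<^sub>M P)"
      "(\<lambda>(z, \<omega>). v z \<omega>) \<in> borel_measurable (\<mu> \<Otimes>\<^sub>M P)"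
    and u: "AE \<omega> in P. AE z in \<mu>. u z \<omega> \<in> \<int>" and \<delta>: "0 < \<delta>" and \<epsilon>: "1 < \<epsilon>"
  shows "(\<integral>\<^sup>+\<omega>. \<integral>\<^sup>+z. ennreal (\<bar>v z \<omega>\<bar> * \<bar>u z \<omega>\<bar>) \<partial>\<mu> \<partial>P)
    \<le> ennreal \<delta> * (\<integral>\<^sup>+\<omega>. \<integral>\<^sup>+z. ennreal ((u z \<omega>)\<^sup>2) \<partial>\<mu> \<partial>P)
      + ennreal (\<delta> powr (- \<epsilon>)) * (\<integral>\<^sup>+\<omega>. \<integral>\<^sup>+z. ennreal (\<bar>v z \<omega>\<bar> powr (1 + \<epsilon>)) \<partial>\<mu> \<partial>P)"
proof -
  have [measurable]: "(\<lambda>(\<omega>, z). u z \<omega>) \<in> borel_measurable (P \<Otimes>\<^sub>M \<mu>)"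
      "(\<lambda>(\<omega>, z). v z \<omega>) \<in> borel_measurable (P \<Otimes>\<^sub>M \<mu>)"
    using measurable_pair_swap[OF assms(1)] measurable_pair_swap[OF assms(2)] by simp_all
  have "(\<integral>\<^sup>+\<omega>. \<integral>\<^sup>+z. ennreal (\<bar>v z \<omega>\<bar> * \<bar>u z \<omega>\<bar>) \<partial>\<mu> \<partial>P)
      \<le> (\<integral>\<^sup>+\<omega>. \<integral>\<^sup>+z. ennreal \<delta> * ennreal ((u z \<omega>)\<^sup>2)
          + ennreal (\<delta> powr (- \<epsilon>)) * ennreal (\<bar>v z \<omega>\<bar> powr (1 + \<epsilon>)) \<partial>\<mu> \<partial>P)"
  proof (rule nn_integral_mono_AE, use u in eventually_elim)
    fix \<omega> assume "AE z in \<mu>. u z \<omega> \<in> \<int>"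
    then have "AE z in \<mu>. ennreal (\<bar>v z \<omega>\<bar> * \<bar>u z \<omega>\<bar>) \<le> ennreal \<delta> * ennreal ((u z \<omega>)\<^sup>2)
        + ennreal (\<delta> powr (- \<epsilon>)) * ennreal (\<bar>v z \<omega>\<bar> powr (1 + \<epsilon>))"
    proof eventually_elim
      case (elim z)
      from ennreal_leI[OF product_le_of_integer[OF this \<delta> \<epsilon>, of "v z \<omega>"]]
      show ?case using \<delta> by (simp add: ennreal_mult)
    qed
    then show "(\<integral>\<^sup>+z. ennreal (\<bar>v z \<omega>\<bar> * \<bar>u z \<omega>\<bar>) \<partial>\<mu>)
        \<le> (\<integral>\<^sup>+z. ennreal \<delta> * ennreal ((u z \<omega>)\<^sup>2)
          + ennreal (\<delta> powr (- \<epsilon>)) * ennreal (\<bar>v z \<omega>\<bar> powr (1 + \<epsilon>)) \<partial>\<mu>)"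
      by (rule nn_integral_mono_AE)
  qed
  also have "\<dots> = (\<integral>\<^sup>+\<omega>. ennreal \<delta> * (\<integral>\<^sup>+z. ennreal ((u z \<omega>)\<^sup>2) \<partial>\<mu>)
      + ennreal (\<delta> powr (- \<epsilon>)) * (\<integral>\<^sup>+z. ennreal (\<bar>v z \<omega>\<bar> powr (1 + \<epsilon>)) \<partial>\<mu>) \<partial>P)"
    by (intro nn_integral_cong) (simp add: nn_integral_add nn_integral_cmult)
  also have "\<dots> = ennreal \<delta> * (\<integral>\<^sup>+\<omega>. \<integral>\<^sup>+z. ennreal ((u z \<omega>)\<^sup>2) \<partial>\<mu> \<partial>P)
      + ennreal (\<delta> powr (- \<epsilon>)) * (\<integral>\<^sup>+\<omega>. \<integral>\<^sup>+z. ennreal (\<bar>v z \<omega>\<bar> powr (1 + \<epsilon>)) \<partial>\<mu> \<partial>P)"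
    by (simp add: nn_integral_add nn_integral_cmult)
  finally show ?thesis .
qed

lemma tendsto_zero_of_scaled_bounds:
  fixes x a v :: "nat \<Rightarrow> ennreal" and K :: "real \<Rightarrow> real"
  assumes le: "\<And>\<delta> n. 0 < \<delta> \<Longrightarrow> 1 \<le> n \<Longrightarrow> x n \<le> ennreal \<delta> * a n + ennreal (K \<delta>) * v n"
    and a: "\<And>n. 1 \<le> n \<Longrightarrow> a n \<le> ennreal C" and v: "v \<longlonglongrightarrow> 0"
  shows "x \<longlonglongrightarrow> 0"
proof (rule order_tendstoI)
  fix e :: ennreal assume "0 < e"
  then obtain e' where e': "0 < e'" "e' < e" using dense by blast
  define r where "r = enn2real e'"
  have "e' < \<top>" using e'(2) by (rule order.strict_trans2) simp
  then have r: "0 < r" "ennreal r < e" using e' by (auto simp: r_def enn2real_positive_iff)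
  \<comment> \<open>With this \<open>\<delta>\<close> the term that does not vanish is at most \<open>r < e\<close>; the added \<open>1\<close> covers \<open>C = 0\<close>.\<close>
  define \<delta> where "\<delta> = r / (\<bar>C\<bar> + 1)"
  have \<delta>: "0 < \<delta>" using r by (simp add: \<delta>_def add_pos_nonneg)
  have "\<delta> * C \<le> r"
  proof -
    have "\<delta> * C \<le> \<delta> * (\<bar>C\<bar> + 1)" using \<delta> by (intro mult_left_mono) auto
    then show ?thesis by (simp add: \<delta>_def)
  qed
  then have "ennreal \<delta> * ennreal C \<le> ennreal r"
    using \<delta> by (simp add: ennreal_leI flip: ennreal_mult')
  then have "ennreal \<delta> * ennreal C + ennreal (K \<delta>) * 0 < e"
    using r(2) by (auto intro: order.strict_trans1)
  moreover have "(\<lambda>n. ennreal \<delta> * ennreal C + ennreal (K \<delta>) * v n)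
      \<longlonglongrightarrow> ennreal \<delta> * ennreal C + ennreal (K \<delta>) * 0"
    by (intro tendsto_add tendsto_const ennreal_tendsto_cmult v) auto
  ultimately have "\<forall>\<^sub>F n in sequentially. ennreal \<delta> * ennreal C + ennreal (K \<delta>) * v n < e"
    by (rule order_tendstoD(2)[rotated])
  then show "\<forall>\<^sub>F n in sequentially. x n < e"
    using eventually_ge_at_top[of 1]
  proof eventually_elim
    case (elim n)
    have "x n \<le> ennreal \<delta> * a n + ennreal (K \<delta>) * v n" using le \<delta> elim by simp
    also have "\<dots> \<le> ennreal \<delta> * ennreal C + ennreal (K \<delta>) * v n"
      using a elim by (intro add_mono mult_left_mono) auto
    finally show ?case using elim by simp
  qed
qed auto

theorem proposition2p1:
  fixes \<mu> :: "'z measure" and P :: "'z measure measure"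
    and d m :: nat and \<epsilon> :: real
    and F G LinvG :: "nat \<Rightarrow> nat \<Rightarrow> 'z measure \<Rightarrow> real"
    and DF DLinvG :: "nat \<Rightarrow> nat \<Rightarrow> 'z \<Rightarrow> 'z measure \<Rightarrow> real"
  assumes "poisson_space \<mu> P"
    and "d \<ge> 1" and "m \<ge> 1"
    and F_dom: "\<And>n i. n \<ge> 1 \<Longrightarrow> i \<in> {1..d} \<Longrightarrow> F n i \<in> dom_D \<mu> P"
    and F_nat: "\<And>n i. n \<ge> 1 \<Longrightarrow> i \<in> {1..d} \<Longrightarrow> AE \<omega> in P. F n i \<omega> \<in> \<nat>"
    and G_dom: "\<And>n j. n \<ge> 1 \<Longrightarrow> j \<in> {1..m} \<Longrightarrow> G n j \<in> dom_D \<mu> P"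
    and G_centered: "\<And>n j. n \<ge> 1 \<Longrightarrow> j \<in> {1..m} \<Longrightarrow> (LINT \<omega>|P. G n j \<omega>) = 0"
    and DF: "\<And>n i. n \<ge> 1 \<Longrightarrow> i \<in> {1..d} \<Longrightarrow> malliavin_derivative \<mu> P (F n i) (DF n i)"
    and LinvG: "\<And>n j. n \<ge> 1 \<Longrightarrow> j \<in> {1..m} \<Longrightarrow> pseudo_inverse_L \<mu> P (G n j) (LinvG n j)"
    and DLinvG: "\<And>n j. n \<ge> 1 \<Longrightarrow> j \<in> {1..m} \<Longrightarrow>
      malliavin_derivative \<mu> P (LinvG n j) (DLinvG n j)"
    and bounded: "\<And>i. i \<in> {1..d} \<Longrightarrow>
      \<exists>C::real. \<forall>n\<ge>1. (\<integral>\<^sup>+ \<omega>. (\<integral>\<^sup>+ z. ennreal ((DF n i z \<omega>)\<^sup>2) \<partial>\<mu>) \<partial>P) \<le> ennreal C"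
    and "\<epsilon> > 1"
    and vanishing: "\<And>j. j \<in> {1..m} \<Longrightarrow>
      (\<lambda>n. \<integral>\<^sup>+ \<omega>. (\<integral>\<^sup>+ z. ennreal (\<bar>DLinvG n j z \<omega>\<bar> powr (1 + \<epsilon>)) \<partial>\<mu>) \<partial>P)
        \<longlonglongrightarrow> 0"
  shows "(\<lambda>n. beta_coefficient \<mu> P d m (DF n) (DLinvG n)) \<longlonglongrightarrow> 0"
proof -
  interpret poisson_space \<mu> P by fact
  have "(\<lambda>n. \<integral>\<^sup>+ \<omega>. (\<integral>\<^sup>+ z. ennreal (\<bar>DLinvG n j z \<omega>\<bar> * \<bar>DF n i z \<omega>\<bar>) \<partial>\<mu>) \<partial>P) \<longlonglongrightarrow> 0"
    if i: "i \<in> {1..d}" and j: "j \<in> {1..m}" for i j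
  proof -
    obtain C where C: "\<And>n. n \<ge> 1 \<Longrightarrow>
        (\<integral>\<^sup>+ \<omega>. (\<integral>\<^sup>+ z. ennreal ((DF n i z \<omega>)\<^sup>2) \<partial>\<mu>) \<partial>P) \<le> ennreal C"
      using bounded[OF i] by blast
    show ?thesis
    proof (rule tendsto_zero_of_scaled_bounds[OF _ C vanishing[OF j]])
      fix \<delta> :: real and n :: nat assume \<delta>: "0 < \<delta>" and n: "1 \<le> n"
      show "(\<integral>\<^sup>+ \<omega>. (\<integral>\<^sup>+ z. ennreal (\<bar>DLinvG n j z \<omega>\<bar> * \<bar>DF n i z \<omega>\<bar>) \<partial>\<mu>) \<partial>P)
          \<le> ennreal \<delta> * (\<integral>\<^sup>+ \<omega>. (\<integral>\<^sup>+ z. ennreal ((DF n i z \<omega>)\<^sup>2) \<partial>\<mu>) \<partial>P)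
            + ennreal (\<delta> powr (- \<epsilon>))
              * (\<integral>\<^sup>+ \<omega>. (\<integral>\<^sup>+ z. ennreal (\<bar>DLinvG n j z \<omega>\<bar> powr (1 + \<epsilon>)) \<partial>\<mu>) \<partial>P)"
        using DF[OF n i] DLinvG[OF n j]
        by (intro nn_integral_product_le derivative_integer[OF DF[OF n i] F_nat[OF n i]] \<delta> \<open>\<epsilon> > 1\<close>)
          (auto simp: malliavin_derivative_def)
    qed
  qed
  then have "(\<lambda>n. beta_coefficient \<mu> P d m (DF n) (DLinvG n)) \<longlonglongrightarrow> (\<Sum>i=1..d. \<Sum>j=1..m. 0)"
    unfolding beta_coefficient_def by (intro tendsto_sum)
  then show ?thesis by simp
qed

end
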